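(* For all positive integers $d\le n$, \begin{align*} \Xi(2n,d)=& \sum_{j=0}^{\lfloor\frac{d-1}{2}\rfloor} \frac{(-1)^{\lfloor\frac{j}{2}\rfloor}\pi^{2j}\,\tilde{\zeta}_n(2n-2j)}{2^{2d-j-2}(2j+1)!} \binom{2d-2j-1}{d} \\ &+\sum_{j=0}^{\lfloor\frac{d-2}4\rfloor} \left(\sum_{\substack{r+s=n-2j\\ r,s\ge 0}} \frac{(-1)^{r} (4^r-1)}{4^{n-2j}}\, \zeta(2r)\, \zeta(2s) \right) \frac{(-1)^j \pi^{4j} }{2^{2d-2j-5}(4j+2)!} \binom{2d-4j-2}{d}, \end{align*} where $\tilde{\zeta}_n(m)=\zeta(m)$ if $n$ is even and $\tilde{\zeta}_n(m)=\zeta(\overline{m})=(2^{1-m}-1)\zeta(m)$ if $n$ is odd. In particular, $\Xi(2n,d)$ is a rational multiple of $\pi^{2n}$.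
   Context: For positive integers $s_1,\dots,s_d$ put $$\xi(2s_1,\dots,2s_d)=\sum_{n_1>\cdots>n_d\ge 1}\frac{(-1)^{s_1n_1}\cdots (-1)^{s_dn_d}}{ n_1^{2s_1}\cdots n_d^{2s_d}},$$ and for positive integers $d\le n$ put $$\Xi(2n,d)=\sum_{\substack{j_1+\cdots+j_d=n\\ j_1,\dots,j_d > 0}}\xi(2j_1,\dots,2j_d).$$ Here $\zeta(m)$ is the Riemann zeta value, with $\zeta(0)=-\tfrac12$, and $\zeta(\overline{m})=\sum_{k\ge1}(-1)^k k^{-m}$ for $m\ge 1$. Empty sums are $0$ (in particular a sum whose upper limit is $-1$). *)

theory Defs
  imports "HOL-Analysis.Analysis"
begin

(* xi [s_1, ..., s_d] is the multiple sum written $\xi(2s_1,\dots,2s_d)$, i.e. the arguments are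
   halved.  It converges absolutely because every exponent is at least 2, so it is rendered as an
   unordered sum over the index lists n_1 > ... > n_d >= 1. *)
definition xi :: "nat list \<Rightarrow> real" where
  "xi ss = (\<Sum>\<^sub>\<infinity> ns \<in> {ns. length ns = length ss \<and> sorted_wrt (>) ns \<and> (\<forall>k\<in>set ns. k \<ge> 1)}.
     (\<Prod>i<length ss. (-1) ^ (ss ! i * ns ! i) / real (ns ! i) ^ (2 * (ss ! i))))"

(* Xi n d is $\Xi(2n,d)$: the first argument is halved as well. *)
definition Xi :: "nat \<Rightarrow> nat \<Rightarrow> real" where
  "Xi n d = (\<Sum>js \<in> {js. length js = d \<and> sum_list js = n \<and> (\<forall>j\<in>set js. j > 0)}. xi js)"

(* Riemann zeta at natural arguments other than 1, where the series diverges and the value is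
   meaningless; at 0 it is the analytically continued value. *)
definition zeta :: "nat \<Rightarrow> real" where
  "zeta m = (if m = 0 then - 1 / 2 else (\<Sum>k. 1 / real (Suc k) ^ m))"

(* $\zeta(\overline{m})$ for m >= 1 *)
definition zeta_bar :: "nat \<Rightarrow> real" where
  "zeta_bar m = (\<Sum>k. (-1) ^ Suc k / real (Suc k) ^ m)"

definition zeta_tilde :: "nat \<Rightarrow> nat \<Rightarrow> real" where
  "zeta_tilde n m = (if even n then zeta m else zeta_bar m)"

end

theory Submission
  imports Defs
begin

text \<open>
  Put \<open>a\<^sub>k = (-1)^k / k^2\<close>. The factor belonging to an index \<open>k\<close> with exponent \<open>j\<close> in a sum
  \<open>\<xi>\<close> is \<open>a\<^sub>k^j\<close>, so summing over all exponents turns the generating function of the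
  numbers \<open>\<Xi>(2n,d)\<close> into a product:
  \<open>\<Sum>\<^bsub>n,d\<^esub> \<Xi>(2n,d) t^n u^d = \<Prod>\<^sub>k (1 + u a\<^sub>k t / (1 - a\<^sub>k t)) = P((1-u)t) / P(t)\<close>
  where \<open>P(t) = \<Prod>\<^sub>k (1 - a\<^sub>k t)\<close>. Comparing coefficients of \<open>u^d\<close>, the series
  \<open>\<Sum>\<^sub>n \<Xi>(2n,d) t^n\<close> times \<open>P\<close> is \<open>P\<close> with its \<open>N\<close>-th coefficient multiplied by
  \<open>(-1)^d (N choose d)\<close>. For the finitely many factors with \<open>k \<le> K\<close> this is an induction on \<open>K\<close>
  (\<open>product_fps_times_truncated_fps\<close>), and \<open>limit_fps_times_nested_fps\<close> lets \<open>K\<close> tend to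
  infinity.

  In the variable \<open>y\<close> with \<open>t = (2y/\<pi>)^2\<close>, splitting the product into even and odd \<open>k\<close>
  gives \<open>y P(t) = sin y cosh y =: S(y)\<close>. The coefficient of \<open>y^(2N+1)\<close> in \<open>S\<close> thus has to
  be multiplied by \<open>(-1)^d (N choose d)\<close>, and \<open>bessel_binomial_identity\<close> expands this polynomial
  in \<open>N\<close> in the binomials \<open>(2N+1 choose i)\<close>, \<open>i \<le> d\<close>. Multiplying the \<open>k\<close>-th coefficient by
  \<open>i! (k choose i)\<close> is the operation \<open>S \<mapsto> y^i S^(i)\<close>, so the generating function is an explicit
  combination of the quotients \<open>y^i S^(i) / S\<close>. Since \<open>S'''' = -4 S\<close>, there are only four kinds:
  \<open>i \<equiv> 1\<close> and \<open>i \<equiv> 3\<close> modulo 4 give \<open>y cot y \<plusminus> y tanh y\<close>, \<open>i \<equiv> 2\<close> gives their product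
  \<open>y cot y \<sdot> y tanh y\<close>, and \<open>i \<equiv> 0\<close> gives constants, each times a power of \<open>y\<close>
  (\<open>scaled_fps_closed_form\<close>). The coefficients of \<open>y cot y\<close> and \<open>y tanh y\<close> are multiples of
  \<open>\<zeta>(2m) / \<pi>^(2m)\<close>; those of \<open>y cot y\<close> follow from the same product formula, applied to
  \<open>a\<^sub>k = 1 / k^2\<close> and \<open>d = 1\<close>. The odd \<open>i\<close> produce the first sum of the theorem, \<open>i \<equiv> 2\<close> the
  second, and the monomials from \<open>i \<equiv> 0\<close> have degree at most \<open>d < 2n\<close> and do not contribute.

  Rationality holds because \<open>S\<close> and the modified series have rational coefficients and
  \<open>S = y + \<dots>\<close>, so the quotient, a series in \<open>y\<close> without any \<open>\<pi>\<close>, is rational.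
\<close>

unbundle no vec_syntax
unbundle fps_syntax

section \<open>Nested sums with bounded indices\<close>

definition decreasing_lists :: "nat \<Rightarrow> nat \<Rightarrow> nat list set" where
  "decreasing_lists m K = {ns. length ns = m \<and> sorted_wrt (>) ns \<and> (\<forall>k\<in>set ns. 1 \<le> k \<and> k \<le> K)}"

definition compositions :: "nat \<Rightarrow> nat \<Rightarrow> nat list set" where
  "compositions d n = {js. length js = d \<and> sum_list js = n \<and> (\<forall>j\<in>set js. j > 0)}"

definition monomial :: "(nat \<Rightarrow> real) \<Rightarrow> nat list \<Rightarrow> nat list \<Rightarrow> real" where
  "monomial a ss ns = (\<Prod>i<length ss. a (ns ! i) ^ (ss ! i))"

definition truncated_sum :: "(nat \<Rightarrow> real) \<Rightarrow> nat \<Rightarrow> nat list \<Rightarrow> real" where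
  "truncated_sum a K ss = (\<Sum>ns\<in>decreasing_lists (length ss) K. monomial a ss ns)"

definition nested_sum :: "(nat \<Rightarrow> real) \<Rightarrow> nat list \<Rightarrow> real" where
  "nested_sum a ss = (\<Sum>\<^sub>\<infinity>ns\<in>(\<Union>K. decreasing_lists (length ss) K). monomial a ss ns)"

definition truncated_fps :: "(nat \<Rightarrow> real) \<Rightarrow> nat \<Rightarrow> nat \<Rightarrow> real fps" where
  "truncated_fps a K d = Abs_fps (\<lambda>n. \<Sum>js\<in>compositions d n. truncated_sum a K js)"

definition nested_fps :: "(nat \<Rightarrow> real) \<Rightarrow> nat \<Rightarrow> real fps" where
  "nested_fps a d = Abs_fps (\<lambda>n. \<Sum>js\<in>compositions d n. nested_sum a js)"

definition product_fps :: "(nat \<Rightarrow> real) \<Rightarrow> nat \<Rightarrow> real fps" where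
  "product_fps a K = (\<Prod>k=1..K. 1 - fps_const (a k) * fps_X)"

lemma finite_decreasing_lists: "finite (decreasing_lists m K)"
proof (rule finite_subset)
  show "decreasing_lists m K \<subseteq> {ns. set ns \<subseteq> {..K} \<and> length ns = m}"
    by (auto simp: decreasing_lists_def)
qed (rule finite_lists_length_eq, simp)

lemma decreasing_lists_mono: "K \<le> L \<Longrightarrow> decreasing_lists m K \<subseteq> decreasing_lists m L"
  by (auto simp: decreasing_lists_def intro: order_trans)

lemma decreasing_lists_0 [simp]: "decreasing_lists 0 K = {[]}"
  by (auto simp: decreasing_lists_def)

lemma decreasing_lists_Suc_0 [simp]: "decreasing_lists (Suc m) 0 = {}"
  by (auto simp: decreasing_lists_def length_Suc_conv)

text \<open>A decreasing list with entries at most \<open>Suc K\<close> can contain \<open>Suc K\<close> only as its head. This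
  is the source of every recursion in \<open>K\<close> below.\<close>

lemma decreasing_lists_Suc:
  "decreasing_lists (Suc m) (Suc K) = decreasing_lists (Suc m) K \<union> (#) (Suc K) ` decreasing_lists m K"
proof (intro equalityI subsetI)
  fix ns assume ns: "ns \<in> decreasing_lists (Suc m) (Suc K)"
  then obtain x xs where x: "ns = x # xs" "length xs = m" "sorted_wrt (>) xs"
      "\<forall>k\<in>set xs. k < x" "\<forall>k\<in>set xs. 1 \<le> k" "1 \<le> x" "x \<le> Suc K"
    by (auto simp: decreasing_lists_def length_Suc_conv)
  show "ns \<in> decreasing_lists (Suc m) K \<union> (#) (Suc K) ` decreasing_lists m K"
  proof (cases "x = Suc K")
    case True
    have "xs \<in> decreasing_lists m K" using x True by (auto simp: decreasing_lists_def)
    with True x show ?thesis by auto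
  next
    case False
    have "\<forall>k\<in>set xs. k \<le> K" using x(4,7) by fastforce
    with False x show ?thesis by (auto simp: decreasing_lists_def)
  qed
qed (auto simp: decreasing_lists_def le_Suc_eq less_Suc_eq_le)

lemma monomial_Nil [simp]: "monomial a [] ns = 1"
  by (simp add: monomial_def)

lemma monomial_Cons: "monomial a (j # js) (k # ns) = a k ^ j * monomial a js ns"
  unfolding monomial_def by (simp add: prod.lessThan_Suc_shift del: prod.lessThan_Suc)

lemma truncated_sum_Nil [simp]: "truncated_sum a K [] = 1"
  by (simp add: truncated_sum_def)

lemma truncated_sum_0 [simp]: "truncated_sum a 0 (j # js) = 0"
  by (simp add: truncated_sum_def)

lemma truncated_sum_Suc:
  "truncated_sum a (Suc K) (j # js) = truncated_sum a K (j # js) + a (Suc K) ^ j * truncated_sum a K js"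
proof -
  have "truncated_sum a (Suc K) (j # js) = truncated_sum a K (j # js)
      + (\<Sum>ns\<in>(#) (Suc K) ` decreasing_lists (length js) K. monomial a (j # js) ns)"
    unfolding truncated_sum_def list.size(4) add_Suc_right add_0_right decreasing_lists_Suc
    by (rule sum.union_disjoint) (auto simp: finite_decreasing_lists, auto simp: decreasing_lists_def)
  thus ?thesis
    by (simp add: sum.reindex truncated_sum_def monomial_Cons sum_distrib_left)
qed

lemma finite_compositions: "finite (compositions d n)"
proof (rule finite_subset)
  show "compositions d n \<subseteq> {js. set js \<subseteq> {..n} \<and> length js = d}"
    using member_le_sum_list by (fastforce simp: compositions_def)
qed (rule finite_lists_length_eq, simp)

lemma compositions_0: "compositions 0 n = (if n = 0 then {[]} else {})"
  by (auto simp: compositions_def)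

lemma compositions_Suc: "compositions (Suc d) n = (\<Union>j\<in>{1..n}. (#) j ` compositions d (n - j))"
proof (intro equalityI subsetI)
  fix js assume "js \<in> compositions (Suc d) n"
  then obtain i ks where "js = i # ks" "length ks = d" "sum_list ks = n - i" "0 < i" "i \<le> n"
      "\<forall>j\<in>set ks. 0 < j"
    by (auto simp: compositions_def length_Suc_conv)
  thus "js \<in> (\<Union>j\<in>{1..n}. (#) j ` compositions d (n - j))"
    by (auto simp: compositions_def)
qed (auto simp: compositions_def)

lemma sum_compositions_Suc:
  "sum f (compositions (Suc d) n) = (\<Sum>j=1..n. \<Sum>js\<in>compositions d (n - j). f (j # js))"
  unfolding compositions_Suc
  by (subst sum.UNION_disjoint) (auto simp: finite_compositions sum.reindex)

lemma truncated_fps_0 [simp]: "truncated_fps a K 0 = 1"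
  by (rule fps_ext) (simp add: truncated_fps_def compositions_0)

text \<open>On admitting one more index, the sum over its possible exponents becomes a geometric series.\<close>

lemma truncated_fps_Suc:
  "truncated_fps a (Suc K) (Suc d) = truncated_fps a K (Suc d)
     + Abs_fps (\<lambda>j. if j = 0 then 0 else a (Suc K) ^ j) * truncated_fps a K d"
proof (rule fps_ext)
  fix n
  let ?g = "\<lambda>j. \<Sum>js\<in>compositions d (n - j). truncated_sum a K js"
  have "(\<Sum>j=1..n. a (Suc K) ^ j * ?g j) = (\<Sum>j=0..n. (if j = 0 then 0 else a (Suc K) ^ j) * ?g j)"
    by (rule sum.mono_neutral_cong_left) auto
  thus "truncated_fps a (Suc K) (Suc d) $ n = (truncated_fps a K (Suc d)
     + Abs_fps (\<lambda>j. if j = 0 then 0 else a (Suc K) ^ j) * truncated_fps a K d) $ n"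
    by (simp add: truncated_fps_def sum_compositions_Suc truncated_sum_Suc sum.distrib
        sum_distrib_left fps_mult_nth)
qed

lemma product_fps_0 [simp]: "product_fps a 0 = 1"
  by (simp add: product_fps_def)

lemma product_fps_Suc: "product_fps a (Suc K) = (1 - fps_const (a (Suc K)) * fps_X) * product_fps a K"
  by (simp add: product_fps_def mult.commute)

lemma product_fps_Suc_nth:
  "product_fps a (Suc K) $ N = product_fps a K $ N - (if N = 0 then 0 else a (Suc K) * product_fps a K $ (N - 1))"
  by (simp add: product_fps_Suc left_diff_distrib mult.assoc)

lemma geometric_fps:
  fixes c :: real
  shows "(1 - fps_const c * fps_X) * Abs_fps (\<lambda>j. if j = 0 then 0 else c ^ j) = fps_const c * fps_X"
proof (rule fps_ext)
  fix n show "((1 - fps_const c * fps_X) * Abs_fps (\<lambda>j. if j = 0 then 0 else c ^ j)) $ n = (fps_const c * fps_X) $ n"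
    by (cases n; cases "n - 1") (auto simp: left_diff_distrib mult.assoc)
qed

text \<open>The coefficient of \<open>u^d\<close> in \<open>\<Prod>\<^bsub>k\<le>K\<^esub> (1 - (1-u) a\<^sub>k t)\<close>, divided by
  \<open>\<Prod>\<^bsub>k\<le>K\<^esub> (1 - a\<^sub>k t)\<close>, is the series of truncated sums. With a factor
  \<open>L = 1 - a t\<close> added, the left-hand side \<open>W\<^sub>d\<close> becomes \<open>L W\<^sub>d + a t W\<^bsub>d-1\<^esub>\<close>, and the
  right-hand side satisfies the same recursion by Pascal's rule.\<close>

lemma product_fps_times_truncated_fps:
  "product_fps a K * truncated_fps a K d = Abs_fps (\<lambda>N. (-1) ^ d * real (N choose d) * product_fps a K $ N)"
proof (induction K arbitrary: d)
  case 0
  show ?case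
  proof (cases d)
    case 0
    thus ?thesis by (auto simp: fps_eq_iff)
  next
    case (Suc e)
    have "truncated_fps a 0 d = 0"
      by (rule fps_ext) (simp add: Suc truncated_fps_def sum_compositions_Suc)
    thus ?thesis by (auto simp: fps_eq_iff Suc)
  qed
next
  case (Suc K)
  show ?case
  proof (cases d)
    case 0
    thus ?thesis by (auto simp: fps_eq_iff)
  next
    case d: (Suc e)
    define c where "c = a (Suc K)"
    define L where "L = 1 - fps_const c * fps_X"
    define W where "W = product_fps a K"
    have "product_fps a (Suc K) * truncated_fps a (Suc K) d
        = L * (W * truncated_fps a K d)
          + (L * Abs_fps (\<lambda>j. if j = 0 then 0 else c ^ j)) * (W * truncated_fps a K e)"
      unfolding product_fps_Suc d truncated_fps_Suc L_def c_def W_def by (simp only: algebra_simps)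
    also have "\<dots> = L * (W * truncated_fps a K d) + fps_const c * fps_X * (W * truncated_fps a K e)"
      unfolding L_def geometric_fps ..
    finally have rec: "product_fps a (Suc K) * truncated_fps a (Suc K) d = \<dots>" .
    show ?thesis
    proof (rule fps_ext)
      fix N
      show "(product_fps a (Suc K) * truncated_fps a (Suc K) d) $ N
          = Abs_fps (\<lambda>N. (-1) ^ d * real (N choose d) * product_fps a (Suc K) $ N) $ N"
        unfolding rec W_def Suc.IH L_def
        by (cases N) (simp_all add: product_fps_Suc_nth c_def d left_diff_distrib mult.assoc algebra_simps)
    qed
  qed
qed

section \<open>Letting the index bound tend to infinity\<close>

lemma power_Suc_add_le:
  fixes x y :: real
  assumes "x \<ge> 0" "y \<ge> 0"
  shows "x ^ Suc m + y * x ^ m \<le> (x + y) ^ Suc m"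
proof -
  have "x ^ Suc m + y * x ^ m = (x + y) * x ^ m" by (simp add: algebra_simps)
  also have "\<dots> \<le> (x + y) * (x + y) ^ m"
    using assms by (intro mult_left_mono power_mono) auto
  finally show ?thesis by simp
qed

lemma abs_product_fps_nth_le: "\<bar>product_fps a K $ N\<bar> \<le> (\<Sum>k=1..K. \<bar>a k\<bar>) ^ N"
proof (induction K arbitrary: N)
  case 0
  show ?case by (cases N) auto
next
  case (Suc K)
  define S where "S = (\<Sum>k=1..K. \<bar>a k\<bar>)"
  have S: "S \<ge> 0" by (simp add: S_def sum_nonneg)
  show ?case
  proof (cases N)
    case 0
    thus ?thesis using Suc.IH[of 0] by (simp add: product_fps_Suc_nth)
  next
    case (Suc M)
    have "\<bar>product_fps a (Suc K) $ N\<bar> \<le> \<bar>product_fps a K $ N\<bar> + \<bar>a (Suc K)\<bar> * \<bar>product_fps a K $ M\<bar>"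
      by (simp add: product_fps_Suc_nth Suc flip: abs_mult)
    also have "\<dots> \<le> S ^ N + \<bar>a (Suc K)\<bar> * S ^ M"
      unfolding S_def by (intro add_mono mult_left_mono Suc.IH) auto
    also have "\<dots> \<le> (S + \<bar>a (Suc K)\<bar>) ^ N"
      unfolding Suc by (rule power_Suc_add_le) (use S in auto)
    finally show ?thesis by (simp add: S_def)
  qed
qed

text \<open>A nested sum over distinct indices is dominated by the unrestricted product of the sums; for
  \<open>b \<le> 1\<close> every positive exponent may first be lowered to 1.\<close>

lemma truncated_sum_le:
  assumes "\<And>k. 0 \<le> b k" "\<And>k. b k \<le> 1" "\<forall>j\<in>set ss. j > 0"
  shows "0 \<le> truncated_sum b K ss \<and> truncated_sum b K ss \<le> (\<Sum>k=1..K. b k) ^ length ss"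
  using assms(3)
proof (induction K arbitrary: ss)
  case 0
  show ?case by (cases ss) auto
next
  case (Suc K)
  define S where "S = (\<Sum>k=1..K. b k)"
  have S: "S \<ge> 0" by (simp add: S_def sum_nonneg assms)
  show ?case
  proof (cases ss)
    case (Cons j js)
    have pos: "j > 0" "\<forall>j\<in>set js. j > 0" using Suc.prems Cons by auto
    have bj: "0 \<le> b (Suc K) ^ j" "b (Suc K) ^ j \<le> b (Suc K)"
      using assms(1,2)[of "Suc K"] pos(1) power_decreasing[of 1 j "b (Suc K)"] by auto
    note IH1 = Suc.IH[OF Suc.prems, folded S_def] and IH2 = Suc.IH[OF pos(2), folded S_def]
    have "truncated_sum b (Suc K) ss = truncated_sum b K ss + b (Suc K) ^ j * truncated_sum b K js"
      by (simp add: Cons truncated_sum_Suc)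
    moreover have "b (Suc K) ^ j * truncated_sum b K js \<le> b (Suc K) * S ^ length js"
      by (rule mult_mono) (use bj IH2 assms(1)[of "Suc K"] in auto)
    moreover have "S ^ Suc (length js) + b (Suc K) * S ^ length js \<le> (S + b (Suc K)) ^ Suc (length js)"
      by (rule power_Suc_add_le) (use S assms in auto)
    moreover have "0 \<le> b (Suc K) ^ j * truncated_sum b K js" using bj IH2 by simp
    ultimately show ?thesis using IH1 by (simp add: S_def Cons)
  qed auto
qed

lemma sum_le_suminf_from_1:
  assumes "summable (\<lambda>k. b k :: real)" "\<And>k. 0 \<le> b k"
  shows "(\<Sum>k=1..K. b k) \<le> suminf b"
  by (rule sum_le_suminf) (use assms in auto)

text \<open>The infinite nested sum is an unordered sum. The uniform bound above makes it absolutely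
  convergent, so that exhausting the index set by the lists with entries at most \<open>K\<close> gives its
  value.\<close>

lemma truncated_sum_tendsto:
  assumes "summable (\<lambda>k. \<bar>a k\<bar>)" "\<And>k. \<bar>a k\<bar> \<le> 1" "\<forall>j\<in>set ss. j > 0"
  shows "(\<lambda>K. truncated_sum a K ss) \<longlonglongrightarrow> nested_sum a ss"
proof -
  define A where "A = (\<Union>K. decreasing_lists (length ss) K)"
  define C where "C = suminf (\<lambda>k. \<bar>a k\<bar>) ^ length ss"
  have absorb: "\<exists>K. F \<subseteq> decreasing_lists (length ss) K" if "finite F" "F \<subseteq> A" for F
    using that
  proof (induction F rule: finite_induct)
    case (insert x F)
    then obtain K L where "F \<subseteq> decreasing_lists (length ss) K" "x \<in> decreasing_lists (length ss) L"
      by (auto simp: A_def)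
    hence "insert x F \<subseteq> decreasing_lists (length ss) (max K L)"
      using decreasing_lists_mono[of K "max K L" "length ss"]
        decreasing_lists_mono[of L "max K L" "length ss"] by auto
    thus ?case by blast
  qed auto
  have abs_mon: "\<bar>monomial a ss ns\<bar> = monomial (\<lambda>k. \<bar>a k\<bar>) ss ns" for ns
    by (simp add: monomial_def abs_prod power_abs)
  have "(\<lambda>ns. norm (monomial a ss ns)) summable_on A"
  proof (rule nonneg_bdd_above_summable_on)
    show "bdd_above (sum (\<lambda>ns. norm (monomial a ss ns)) ` {F. F \<subseteq> A \<and> finite F})"
    proof (rule bdd_aboveI2)
      fix F assume "F \<in> {F. F \<subseteq> A \<and> finite F}"
      then obtain K where K: "F \<subseteq> decreasing_lists (length ss) K" using absorb by blast
      have "(\<Sum>ns\<in>F. norm (monomial a ss ns))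
          \<le> (\<Sum>ns\<in>decreasing_lists (length ss) K. norm (monomial a ss ns))"
        by (rule sum_mono2) (use K finite_decreasing_lists in auto)
      also have "\<dots> = truncated_sum (\<lambda>k. \<bar>a k\<bar>) K ss"
        by (simp add: truncated_sum_def abs_mon)
      also have "\<dots> \<le> (\<Sum>k=1..K. \<bar>a k\<bar>) ^ length ss"
        using truncated_sum_le[of "\<lambda>k. \<bar>a k\<bar>" ss K] assms by auto
      also have "\<dots> \<le> C" unfolding C_def
        by (intro power_mono sum_le_suminf_from_1 sum_nonneg assms) auto
      finally show "(\<Sum>ns\<in>F. norm (monomial a ss ns)) \<le> C" .
    qed
  qed auto
  hence "(\<lambda>ns. monomial a ss ns) summable_on A" by (rule abs_summable_summable)
  hence "(monomial a ss has_sum nested_sum a ss) A"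
    by (simp add: nested_sum_def A_def)
  moreover have "filterlim (\<lambda>K. decreasing_lists (length ss) K) (finite_subsets_at_top A) sequentially"
    unfolding filterlim_finite_subsets_at_top
  proof (intro allI impI)
    fix X assume "finite X \<and> X \<subseteq> A"
    then obtain K where K: "X \<subseteq> decreasing_lists (length ss) K" using absorb by blast
    show "\<forall>\<^sub>F y in sequentially. finite (decreasing_lists (length ss) y) \<and>
        X \<subseteq> decreasing_lists (length ss) y \<and> decreasing_lists (length ss) y \<subseteq> A"
      using eventually_ge_at_top[of K]
    proof eventually_elim
      case (elim y)
      thus ?case using K decreasing_lists_mono[OF elim, of "length ss"]
        by (auto simp: A_def finite_decreasing_lists)
    qed
  qed
  ultimately have "((\<lambda>K. sum (monomial a ss) (decreasing_lists (length ss) K)) \<longlongrightarrow> nested_sum a ss) sequentially"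
    unfolding has_sum_def by (rule filterlim_compose)
  thus ?thesis by (simp add: truncated_sum_def)
qed

lemma truncated_fps_nth_tendsto:
  assumes "summable (\<lambda>k. \<bar>a k\<bar>)" "\<And>k. \<bar>a k\<bar> \<le> 1"
  shows "(\<lambda>K. truncated_fps a K d $ n) \<longlonglongrightarrow> nested_fps a d $ n"
  unfolding truncated_fps_def nested_fps_def fps_nth_Abs_fps
  by (intro tendsto_sum truncated_sum_tendsto assms) (auto simp: compositions_def)

lemma limit_fps_times_nested_fps:
  assumes "summable (\<lambda>k. \<bar>a k\<bar>)" "\<And>k. \<bar>a k\<bar> \<le> 1"
  assumes P: "\<And>N. (\<lambda>K. product_fps a K $ N) \<longlonglongrightarrow> P $ N"
  shows "P * nested_fps a d = Abs_fps (\<lambda>N. (-1) ^ d * real (N choose d) * P $ N)"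
proof (rule fps_ext)
  fix N
  have "(\<lambda>K. (product_fps a K * truncated_fps a K d) $ N) \<longlonglongrightarrow> (P * nested_fps a d) $ N"
    unfolding fps_mult_nth by (intro tendsto_intros truncated_fps_nth_tendsto assms)
  moreover have "(\<lambda>K. (product_fps a K * truncated_fps a K d) $ N)
      \<longlonglongrightarrow> (-1) ^ d * real (N choose d) * P $ N"
    unfolding product_fps_times_truncated_fps fps_nth_Abs_fps by (intro tendsto_intros P)
  ultimately show "(P * nested_fps a d) $ N = Abs_fps (\<lambda>N. (-1) ^ d * real (N choose d) * P $ N) $ N"
    using LIMSEQ_unique by fastforce
qed

lemma sums_product_fps: "(\<lambda>N. product_fps a K $ N * t ^ N) sums (\<Prod>k=1..K. 1 - a k * t)"
proof (induction K)
  case 0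
  have "(\<lambda>N. if N = 0 then 1 else 0) sums (1::real)" using sums_single[of 0 "\<lambda>_. 1::real"] by simp
  thus ?case by (simp add: if_distrib[of "\<lambda>x. x * _"] cong: if_cong)
next
  case (Suc K)
  let ?c = "a (Suc K)" and ?P = "\<Prod>k=1..K. 1 - a k * t"
  have "(\<lambda>N. ?c * t * (product_fps a K $ N * t ^ N)) sums (?c * t * ?P)"
    by (rule sums_mult[OF Suc.IH])
  hence "(\<lambda>N. (if N = 0 then 0 else ?c * product_fps a K $ (N - 1)) * t ^ N) sums (?c * t * ?P)"
    using sums_Suc[of "\<lambda>N. (if N = 0 then 0 else ?c * product_fps a K $ (N - 1)) * t ^ N" "?c * t * ?P"]
    by (simp add: mult_ac)
  from sums_diff[OF Suc.IH this] show ?case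
    by (simp add: product_fps_Suc_nth algebra_simps)
qed

text \<open>Each coefficient of the partial products converges because its increments are dominated by
  \<open>\<bar>a\<^bsub>K+1\<^esub>\<bar> C^M\<close> with \<open>C = \<Sum> \<bar>a\<^sub>k\<bar>\<close>. As the \<open>N\<close>-th coefficient is at most \<open>C^N\<close>, dominated
  convergence (Tannery) identifies the limit series with the infinite product near 0.\<close>

lemma product_fps_tendsto:
  assumes "summable (\<lambda>k. \<bar>a k\<bar>)"
  obtains P where "\<And>N. (\<lambda>K. product_fps a K $ N) \<longlonglongrightarrow> P $ N"
    and "\<And>t. \<bar>t\<bar> * suminf (\<lambda>k. \<bar>a k\<bar>) < 1 \<Longrightarrow> summable (\<lambda>N. P $ N * t ^ N)"
    and "\<And>t. \<bar>t\<bar> * suminf (\<lambda>k. \<bar>a k\<bar>) < 1 \<Longrightarrow>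
           (\<lambda>K. \<Prod>k=1..K. 1 - a k * t) \<longlonglongrightarrow> (\<Sum>N. P $ N * t ^ N)"
proof -
  define C where "C = suminf (\<lambda>k. \<bar>a k\<bar>)"
  have C0: "C \<ge> 0" unfolding C_def by (rule suminf_nonneg[OF assms]) auto
  have bound: "\<bar>product_fps a K $ N\<bar> \<le> C ^ N" for K N
  proof -
    have "\<bar>product_fps a K $ N\<bar> \<le> (\<Sum>k=1..K. \<bar>a k\<bar>) ^ N" by (rule abs_product_fps_nth_le)
    also have "\<dots> \<le> C ^ N" unfolding C_def
      by (intro power_mono sum_le_suminf_from_1 sum_nonneg assms) auto
    finally show ?thesis .
  qed
  have "convergent (\<lambda>K. product_fps a K $ N)" for N
  proof (cases N)
    case 0
    have "product_fps a K $ 0 = 1" for K by (induction K) (auto simp: product_fps_Suc_nth)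
    thus ?thesis using 0 by (simp add: convergent_const)
  next
    case (Suc M)
    define g where "g K = - (a (Suc K) * product_fps a K $ M)" for K
    have "summable g"
    proof (rule summable_comparison_test')
      show "summable (\<lambda>K. \<bar>a (Suc K)\<bar> * C ^ M)"
        by (intro summable_mult2) (use assms summable_Suc_iff[of "\<lambda>k. \<bar>a k\<bar>"] in auto)
      show "norm (g K) \<le> \<bar>a (Suc K)\<bar> * C ^ M" if "K \<ge> 0" for K
        unfolding g_def by (auto simp: abs_mult intro!: mult_left_mono bound)
    qed
    hence "convergent (\<lambda>K. \<Sum>i<K. g i)" by (simp add: summable_iff_convergent)
    moreover have "product_fps a K $ N = (\<Sum>i<K. g i)" for K
      by (induction K) (auto simp: product_fps_Suc_nth Suc g_def)
    ultimately show ?thesis by simp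
  qed
  hence "\<forall>N. \<exists>l. (\<lambda>K. product_fps a K $ N) \<longlonglongrightarrow> l" by (auto simp: convergent_def)
  then obtain p where p: "\<And>N. (\<lambda>K. product_fps a K $ N) \<longlonglongrightarrow> p N" by metis
  show ?thesis
  proof (rule that[of "Abs_fps p"], unfold fps_nth_Abs_fps)
    fix t assume "\<bar>t\<bar> * suminf (\<lambda>k. \<bar>a k\<bar>) < 1"
    hence t: "norm (C * \<bar>t\<bar>) < 1" using C0 by (simp add: C_def abs_mult mult.commute)
    let ?F = "\<lambda>N K. product_fps a K $ N * t ^ N"
    have "eventually (\<lambda>K. summable (\<lambda>N. norm (?F N K))) sequentially \<and>
        summable (\<lambda>N. norm (p N * t ^ N)) \<and>
        ((\<lambda>K. suminf (\<lambda>N. ?F N K)) \<longlongrightarrow> suminf (\<lambda>N. p N * t ^ N)) sequentially"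
    proof (rule tannerys_theorem)
      show "(\<lambda>K. ?F N K) \<longlonglongrightarrow> p N * t ^ N" for N by (intro tendsto_intros p)
      show "\<forall>\<^sub>F (N, K) in sequentially \<times>\<^sub>F sequentially. norm (?F N K) \<le> (C * \<bar>t\<bar>) ^ N"
        by (auto intro!: always_eventually mult_right_mono bound
              simp: abs_mult power_abs power_mult_distrib)
      show "summable (\<lambda>N. (C * \<bar>t\<bar>) ^ N)" using t by (rule summable_geometric)
    qed auto
    thus "summable (\<lambda>N. p N * t ^ N)"
      and "(\<lambda>K. \<Prod>k=1..K. 1 - a k * t) \<longlonglongrightarrow> (\<Sum>N. p N * t ^ N)"
      using sums_unique[OF sums_product_fps[of a _ t]]
      by (auto intro: summable_norm_cancel)
  qed (rule p)
qed

section \<open>Identifying the limit series\<close>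

text \<open>A series in \<open>t\<close>, read as an even series in \<open>y\<close> through \<open>t = y^2\<close>.\<close>

definition even_lift :: "real fps \<Rightarrow> real fps" where
  "even_lift f = f oo fps_X\<^sup>2"

lemma even_lift_nth: "even_lift f $ n = (if even n then f $ (n div 2) else 0)"
proof -
  have "even_lift f $ n = (\<Sum>i=0..n. if n = 2 * i then f $ i else 0)"
    by (auto simp: even_lift_def fps_compose_nth simp flip: power_mult intro!: sum.cong)
  also have "\<dots> = (if even n then f $ (n div 2) else 0)"
  proof (cases "even n")
    case True
    then obtain m where "n = 2 * m" by blast
    thus ?thesis by simp
  next
    case False
    hence "n \<noteq> 2 * i" for i by auto
    thus ?thesis using False by simp
  qed
  finally show ?thesis .
qed

lemma even_lift_mult: "even_lift (f * g) = even_lift f * even_lift g"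
  unfolding even_lift_def by (rule fps_compose_mult_distrib) simp

lemma even_lift_inject: "even_lift f = even_lift g \<Longrightarrow> f = g"
  by (metis (no_types) dvd_triv_left even_lift_nth fps_ext nonzero_mult_div_cancel_left zero_neq_numeral)

lemma odd_lift_nth: "(fps_X * even_lift f) $ n = (if odd n then f $ (n div 2) else 0)"
  by (cases n) (auto simp: even_lift_nth elim!: evenE)

text \<open>If the series differed, the first coefficient where they do would be the limit at 0 of the zero
  function divided by a power of \<open>x\<close>.\<close>

lemma has_fps_expansion_real_unique:
  fixes f :: "real \<Rightarrow> real"
  assumes "f has_fps_expansion F" "f has_fps_expansion G"
  shows "F = G"
proof (rule ccontr)
  assume neq: "F \<noteq> G"
  define n where "n = subdegree (F - G)"
  define h where "h = (\<lambda>x::real. if x = 0 then (F - G) $ n else 0)"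
  have "(\<lambda>x. f x - f x) has_fps_expansion (F - G)"
    by (intro has_fps_expansion_diff assms)
  from has_fps_expansion_shift[OF this, of n "(F - G) $ n"]
  have "h has_fps_expansion fps_shift n (F - G)"
    by (simp add: n_def h_def cong: if_cong)
  hence "isCont h 0" by (rule has_fps_expansion_imp_continuous)
  hence "h \<midarrow>0\<rightarrow> (F - G) $ n" by (simp add: isCont_def h_def)
  moreover have "h \<midarrow>0\<rightarrow> 0"
    by (rule Lim_transform_eventually[OF tendsto_const])
       (auto simp: h_def eventually_at_filter)
  ultimately have "(F - G) $ n = 0" by (rule LIM_unique)
  moreover have "(F - G) $ n \<noteq> 0"
    unfolding n_def using neq by (intro nth_subdegree_nonzero) simp
  ultimately show False by contradiction
qed

text \<open>Convergence of the partial products along one subsequence is enough to recognise the limit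
  series, because the full sequence is already known to converge. For alternating signs only the
  products with an even number of factors split evenly.\<close>

lemma product_fps_tendsto_expansion:
  assumes "summable (\<lambda>k. \<bar>a k\<bar>)" "strict_mono r"
  assumes lim: "\<And>y. (\<lambda>M. y * (\<Prod>k=1..r M. 1 - a k * (l * y)\<^sup>2)) \<longlonglongrightarrow> g y"
  assumes g: "g has_fps_expansion G"
  obtains P where "\<And>N. (\<lambda>K. product_fps a K $ N) \<longlonglongrightarrow> P $ N"
    and "G = fps_X * even_lift (Abs_fps (\<lambda>N. l ^ (2 * N) * P $ N))"
proof -
  obtain P where P: "\<And>N. (\<lambda>K. product_fps a K $ N) \<longlonglongrightarrow> P $ N"
    and sP: "\<And>t. \<bar>t\<bar> * suminf (\<lambda>k. \<bar>a k\<bar>) < 1 \<Longrightarrow> summable (\<lambda>N. P $ N * t ^ N)"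
    and lP: "\<And>t. \<bar>t\<bar> * suminf (\<lambda>k. \<bar>a k\<bar>) < 1 \<Longrightarrow>
           (\<lambda>K. \<Prod>k=1..K. 1 - a k * t) \<longlonglongrightarrow> (\<Sum>N. P $ N * t ^ N)"
    using product_fps_tendsto[OF assms(1)] by blast
  define F where "F = fps_X * even_lift (Abs_fps (\<lambda>N. l ^ (2 * N) * P $ N))"
  have "g has_fps_expansion F"
  proof (rule has_fps_expansionI)
    have "((\<lambda>y. \<bar>(l * y)\<^sup>2\<bar> * suminf (\<lambda>k. \<bar>a k\<bar>)) \<longlongrightarrow> \<bar>(l * 0)\<^sup>2\<bar> * suminf (\<lambda>k. \<bar>a k\<bar>)) (nhds 0)"
      by (intro tendsto_intros filterlim_ident)
    hence "eventually (\<lambda>y. \<bar>(l * y)\<^sup>2\<bar> * suminf (\<lambda>k. \<bar>a k\<bar>) < 1) (nhds 0)"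
      by (rule order_tendstoD) simp
    thus "eventually (\<lambda>y. (\<lambda>n. F $ n * y ^ n) sums g y) (nhds 0)"
    proof eventually_elim
      case (elim y)
      let ?t = "(l * y)\<^sup>2"
      have "(\<lambda>M. y * (\<Prod>k=1..r M. 1 - a k * ?t)) \<longlonglongrightarrow> y * (\<Sum>N. P $ N * ?t ^ N)"
        using LIMSEQ_subseq_LIMSEQ[OF lP[OF elim] assms(2)]
        by (intro tendsto_mult tendsto_const) (simp add: o_def)
      hence "g y = y * (\<Sum>N. P $ N * ?t ^ N)" using lim LIMSEQ_unique by blast
      hence "(\<lambda>N. y * (P $ N * ?t ^ N)) sums g y"
        using summable_sums[OF sP[OF elim]] by (simp add: sums_mult)
      moreover have "y * (P $ N * ?t ^ N) = F $ (2 * N + 1) * y ^ (2 * N + 1)" for N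
        unfolding F_def odd_lift_nth by (simp add: power_mult_distrib flip: power_mult)
      ultimately have "(\<lambda>N. F $ (2 * N + 1) * y ^ (2 * N + 1)) sums g y" by simp
      thus ?case
        by (subst (asm) sums_mono_reindex[of "\<lambda>N. 2 * N + 1" "\<lambda>n. F $ n * y ^ n"])
           (auto simp: strict_mono_def F_def odd_lift_nth simp del: fps_X_mult_nth elim!: oddE)
    qed
  qed
  from has_fps_expansion_real_unique[OF g this] show ?thesis
    by (intro that[OF P]) (simp add: F_def)
qed

section \<open>Infinite products for sine and sine times hyperbolic cosine\<close>

lemma sinh_product_formula_real:
  "(\<lambda>n. y * (\<Prod>k=1..n. 1 + (y / pi)\<^sup>2 / (real k)\<^sup>2)) \<longlonglongrightarrow> sinh (y::real)"
proof -
  define z where "z = \<i> * complex_of_real (y / pi)"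
  have z2: "z\<^sup>2 = - complex_of_real ((y / pi)\<^sup>2)" by (simp add: z_def power_mult_distrib power_divide)
  have piz: "complex_of_real pi * z = \<i> * complex_of_real y" by (simp add: z_def)
  have "(\<lambda>n. \<i> * complex_of_real (y * (\<Prod>k=1..n. 1 + (y / pi)\<^sup>2 / (real k)\<^sup>2))) \<longlonglongrightarrow> sin (\<i> * complex_of_real y)"
    using sin_product_formula_complex[of z] unfolding piz z2 by (simp add: mult.assoc)
  also have "sin (\<i> * complex_of_real y) = \<i> * complex_of_real (sinh y)"
    by (simp add: sin_i_times sinh_field_def exp_minus flip: exp_of_real)
  finally have "(\<lambda>n. \<i> * complex_of_real (y * (\<Prod>k=1..n. 1 + (y / pi)\<^sup>2 / (real k)\<^sup>2)) / \<i>)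
      \<longlonglongrightarrow> \<i> * complex_of_real (sinh y) / \<i>"
    by (intro tendsto_divide tendsto_const) auto
  thus ?thesis by (simp flip: of_real_prod of_real_mult add: tendsto_of_real_iff)
qed

definition signed_inverse_square :: "nat \<Rightarrow> real" where
  "signed_inverse_square k = (-1) ^ k / (real k)\<^sup>2"

lemma prod_even_odd: "(\<Prod>k=1..2 * (n::nat). f k) = (\<Prod>m=1..n. f (2 * m)) * (\<Prod>m=1..n. f (2 * m - 1) :: real)"
  by (induction n) (simp_all add: mult_ac)

text \<open>The even \<open>k\<close> give the sine product. The odd \<open>k\<close> give \<open>cosh y\<close>: dividing the product
  of \<open>sinh (2y)\<close> by that of \<open>sinh y\<close> removes its even factors, and
  \<open>sinh (2y) = 2 sinh y cosh y\<close>.\<close>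

lemma sin_cosh_product_formula:
  fixes y :: real
  shows "(\<lambda>M. y * (\<Prod>k=1..2*M. 1 - signed_inverse_square k * (2 / pi * y)\<^sup>2)) \<longlonglongrightarrow> sin y * cosh y"
proof (cases "y = 0")
  case False
  define A where "A n x = x * (\<Prod>k=1..n. 1 + (x / pi)\<^sup>2 / (real k)\<^sup>2)" for n x
  define E where "E n = (\<Prod>m=1..n. 1 + (y / pi)\<^sup>2 / (real m)\<^sup>2)" for n
  define Od where "Od n = (\<Prod>m=1..n. 1 + (2 * y / pi)\<^sup>2 / (real (2 * m - 1))\<^sup>2)" for n
  have E_pos: "E n > 0" for n
    unfolding E_def by (intro prod_pos ballI add_pos_nonneg) auto
  have "A (2 * n) (2 * y) = 2 * y * (E n * Od n)" for n
    unfolding A_def E_def Od_def prod_even_odd by (simp add: power_divide power_mult_distrib)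
  moreover have "A n y = y * E n" for n unfolding A_def E_def ..
  ultimately have Od_eq: "Od n = A (2 * n) (2 * y) / (2 * A n y)" for n
    using E_pos[of n] False by simp
  have "(\<lambda>n. A n (2 * y)) \<longlonglongrightarrow> sinh (2 * y)" "(\<lambda>n. A n y) \<longlonglongrightarrow> sinh y"
    unfolding A_def by (rule sinh_product_formula_real)+
  moreover have "strict_mono (\<lambda>n::nat. 2 * n)" by (simp add: strict_mono_def)
  ultimately have "(\<lambda>n. A (2 * n) (2 * y) / (2 * A n y)) \<longlonglongrightarrow> sinh (2 * y) / (2 * sinh y)"
    using False LIMSEQ_subseq_LIMSEQ[of "\<lambda>n. A n (2 * y)" _ "\<lambda>n. 2 * n"]
    by (intro tendsto_intros) (auto simp: o_def)
  hence limO: "Od \<longlonglongrightarrow> cosh y" using False by (simp add: Od_eq[abs_def] sinh_double)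
  have "(\<lambda>n. pi * (y / pi) * (\<Prod>k=1..n. 1 - (y / pi)\<^sup>2 / (real k)\<^sup>2)) \<longlonglongrightarrow> sin (pi * (y / pi))"
    by (rule sin_product_formula_real)
  from tendsto_mult[OF this limO]
  show ?thesis unfolding prod_even_odd Od_def
    by (simp add: signed_inverse_square_def power_divide power_mult_distrib mult_ac)
qed simp

lemma summable_inverse_square: "summable (\<lambda>k. 1 / (real k)\<^sup>2)"
  using inverse_power_summable[of 2, where ?'a = real] by (simp add: field_simps)

definition sinh_fps :: "real fps" where
  "sinh_fps = fps_const (1/2) * (fps_exp 1 - fps_exp (-1))"

definition cosh_fps :: "real fps" where
  "cosh_fps = fps_const (1/2) * (fps_exp 1 + fps_exp (-1))"

lemma has_fps_expansion_cosh: "(cosh :: real \<Rightarrow> real) has_fps_expansion cosh_fps"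
proof -
  have "(\<lambda>x::real. 1/2 * (exp x + exp (-x))) has_fps_expansion cosh_fps"
    unfolding cosh_fps_def by (intro fps_expansion_intros)
  thus ?thesis by (simp add: cosh_def[abs_def] scaleR_conv_of_real)
qed

text \<open>The coefficientwise identity for the limit, transported to the variable \<open>y\<close> in which the
  product is an elementary function \<open>g\<close>. Here \<open>k div 2\<close> is \<open>N\<close> for the exponent \<open>k = 2N + 1\<close>, and
  the coefficients at even exponents vanish on both sides.\<close>

lemma expansion_times_nested_fps:
  assumes "summable (\<lambda>k. \<bar>a k\<bar>)" "\<And>k. \<bar>a k\<bar> \<le> 1" "strict_mono r"
  assumes lim: "\<And>y. (\<lambda>M. y * (\<Prod>k=1..r M. 1 - a k * (l * y)\<^sup>2)) \<longlonglongrightarrow> g y"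
  assumes g: "g has_fps_expansion G"
  shows "G * even_lift (Abs_fps (\<lambda>n. l ^ (2 * n) * nested_fps a d $ n))
    = Abs_fps (\<lambda>k. (-1) ^ d * real ((k div 2) choose d) * G $ k)"
proof -
  obtain P where P: "\<And>N. (\<lambda>K. product_fps a K $ N) \<longlonglongrightarrow> P $ N"
    and G: "G = fps_X * even_lift (Abs_fps (\<lambda>N. l ^ (2 * N) * P $ N))"
    using product_fps_tendsto_expansion[OF assms(1,3,4,5)] by blast
  let ?Q = "Abs_fps (\<lambda>N. l ^ (2 * N) * P $ N)" and ?Y = "Abs_fps (\<lambda>n. l ^ (2 * n) * nested_fps a d $ n)"
  have "?Q * ?Y = Abs_fps (\<lambda>N. l ^ (2 * N) * (P * nested_fps a d) $ N)"
  proof (rule fps_ext)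
    fix N
    have eq: "l ^ (2 * N) * (P $ i * nested_fps a d $ (N - i))
        = (l ^ (2 * i) * P $ i) * (l ^ (2 * (N - i)) * nested_fps a d $ (N - i))" if "i \<in> {0..N}" for i
    proof -
      have "2 * N = 2 * i + 2 * (N - i)" using that by simp
      thus ?thesis by (simp only: power_add mult_ac)
    qed
    show "(?Q * ?Y) $ N = Abs_fps (\<lambda>N. l ^ (2 * N) * (P * nested_fps a d) $ N) $ N"
      unfolding fps_mult_nth fps_nth_Abs_fps sum_distrib_left
      by (rule sum.cong[OF refl]) (rule eq[symmetric])
  qed
  also have "\<dots> = Abs_fps (\<lambda>N. (-1) ^ d * real (N choose d) * ?Q $ N)"
    unfolding limit_fps_times_nested_fps[OF assms(1,2) P] by (simp add: mult_ac)
  finally have "G * even_lift ?Y = fps_X * even_lift (Abs_fps (\<lambda>N. (-1) ^ d * real (N choose d) * ?Q $ N))"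
    unfolding G mult.assoc even_lift_mult[symmetric] by simp
  thus ?thesis unfolding G by (simp add: fps_eq_iff odd_lift_nth del: fps_X_mult_nth)
qed

abbreviation sin_cosh_fps :: "real fps" where
  "sin_cosh_fps \<equiv> fps_sin 1 * cosh_fps"

lemma sin_cosh_times_nested_fps:
  "fps_sin 1 * cosh_fps * even_lift (Abs_fps (\<lambda>n. (2 / pi) ^ (2 * n) * nested_fps signed_inverse_square d $ n))
    = Abs_fps (\<lambda>k. (-1) ^ d * real ((k div 2) choose d) * (fps_sin 1 * cosh_fps) $ k)"
proof (rule expansion_times_nested_fps[where r = "\<lambda>M. 2 * M" and g = "\<lambda>y. sin y * cosh y"])
  show "summable (\<lambda>k. \<bar>signed_inverse_square k\<bar>)"
    using summable_inverse_square by (simp add: signed_inverse_square_def power_abs)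
  show "\<bar>signed_inverse_square k\<bar> \<le> 1" for k
    by (cases "k = 0") (auto simp: signed_inverse_square_def power_abs)
  show "(\<lambda>y. sin y * cosh y) has_fps_expansion fps_sin 1 * cosh_fps"
    by (intro has_fps_expansion_mult has_fps_expansion_sin' has_fps_expansion_cosh)
qed (use sin_cosh_product_formula in \<open>auto simp: strict_mono_def\<close>)

lemma sin_times_nested_fps:
  "fps_sin 1 * even_lift (Abs_fps (\<lambda>n. (1 / pi) ^ (2 * n) * nested_fps (\<lambda>k. 1 / (real k)\<^sup>2) d $ n))
    = Abs_fps (\<lambda>k. (-1) ^ d * real ((k div 2) choose d) * fps_sin 1 $ k)"
proof (rule expansion_times_nested_fps[where r = id and g = sin])
  show "summable (\<lambda>k. \<bar>1 / (real k)\<^sup>2\<bar>)" using summable_inverse_square by simp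
  show "\<bar>1 / (real k)\<^sup>2\<bar> \<le> 1" for k by (cases "k = 0") auto
  show "(\<lambda>M. y * (\<Prod>k=1..id M. 1 - 1 / (real k)\<^sup>2 * (1 / pi * y)\<^sup>2)) \<longlonglongrightarrow> sin y" for y
    using sin_product_formula_real[of "y / pi"] by (simp add: power_divide mult.commute)
qed (use has_fps_expansion_sin' in \<open>auto simp: strict_mono_def\<close>)

section \<open>Zeta values as Taylor coefficients\<close>

lemma compositions_1: "compositions 1 n = (if n = 0 then {} else {[n]})"
  by (auto simp: compositions_def length_Suc_conv)

lemma nested_sum_inverse_square:
  assumes "n > 0"
  shows "nested_sum (\<lambda>k. 1 / (real k)\<^sup>2) [n] = zeta (2 * n)"
proof -
  let ?a = "\<lambda>k. 1 / (real k)\<^sup>2"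
  have "(\<lambda>K. truncated_sum ?a K [n]) \<longlonglongrightarrow> nested_sum ?a [n]"
  proof (rule truncated_sum_tendsto)
    show "summable (\<lambda>k. \<bar>1 / (real k)\<^sup>2\<bar>)" using summable_inverse_square by simp
    show "\<bar>1 / (real k)\<^sup>2\<bar> \<le> 1" for k by (cases "k = 0") auto
  qed (use assms in auto)
  moreover have "truncated_sum ?a K [n] = (\<Sum>k<K. 1 / real (Suc k) ^ (2 * n))" for K
    by (induction K) (simp_all add: truncated_sum_Suc power_one_over power_mult power_divide)
  moreover have "summable (\<lambda>k. 1 / real (Suc k) ^ (2 * n))"
    using inverse_power_summable[of "2 * n", where ?'a = real] assms
    by (subst summable_Suc_iff) (simp add: field_simps)
  hence "(\<lambda>K. \<Sum>k<K. 1 / real (Suc k) ^ (2 * n)) \<longlonglongrightarrow> zeta (2 * n)"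
    using assms unfolding zeta_def by (simp add: summable_LIMSEQ)
  ultimately show ?thesis using LIMSEQ_unique by fastforce
qed

text \<open>The expansion of \<open>y cot y\<close> in powers of \<open>y^2\<close>; the value \<open>\<zeta>(0) = -1/2\<close> gives its constant
  term 1.\<close>

definition cot_fps :: "real fps" where
  "cot_fps = Abs_fps (\<lambda>m. - 2 * zeta (2 * m) / pi ^ (2 * m))"

text \<open>For \<open>d = 1\<close> the nested sums are the values \<open>\<zeta>(2n)\<close>, and multiplying the coefficient of
  \<open>y^(2N+1)\<close> by \<open>1 + 2N\<close> is the operation \<open>y d/dy\<close>.\<close>

lemma sin_times_cot_fps: "fps_sin 1 * even_lift cot_fps = fps_X * fps_cos 1"
proof -
  let ?Y = "Abs_fps (\<lambda>n. (1 / pi) ^ (2 * n) * nested_fps (\<lambda>k. 1 / (real k)\<^sup>2) 1 $ n)"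
  have "even_lift cot_fps = 1 - 2 * even_lift ?Y"
  proof (rule fps_ext)
    fix n
    show "even_lift cot_fps $ n = (1 - 2 * even_lift ?Y) $ n"
    proof (cases "n = 0")
      case True
      thus ?thesis
        by (simp add: even_lift_nth cot_fps_def zeta_def nested_fps_def compositions_1[simplified] numeral_fps_const)
    next
      case False
      thus ?thesis
        by (auto simp: even_lift_nth cot_fps_def nested_fps_def compositions_1[simplified]
            nested_sum_inverse_square numeral_fps_const power_divide elim!: evenE)
    qed
  qed
  hence "fps_sin 1 * even_lift cot_fps = fps_sin 1 - 2 * (fps_sin 1 * even_lift ?Y)"
    by (simp only: right_diff_distrib mult.left_commute mult_1_right)
  also have "\<dots> = fps_X * fps_deriv (fps_sin 1)"
    unfolding sin_times_nested_fps
  proof (rule fps_ext)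
    fix k
    show "(fps_sin 1 - 2 * Abs_fps (\<lambda>k. (-1) ^ 1 * real ((k div 2) choose 1) * fps_sin 1 $ k)) $ k
        = (fps_X * fps_deriv (fps_sin 1)) $ k"
      by (cases "even k") (auto simp: numeral_fps_const fps_sin_def algebra_simps add_divide_distrib elim!: evenE oddE)
  qed
  finally show ?thesis by (simp add: fps_sin_deriv)
qed

text \<open>Replacing \<open>t\<close> by \<open>-t\<close>, that is \<open>y\<close> by \<open>\<i>y\<close>, which turns trigonometric into hyperbolic
  functions without leaving the reals.\<close>

definition twist :: "real fps \<Rightarrow> real fps" where
  "twist f = Abs_fps (\<lambda>n. (-1) ^ n * f $ n)"

lemma twist_mult: "twist (f * g) = twist f * twist g"
proof (rule fps_ext)
  fix n
  have eq: "(-1) ^ n * (f $ i * g $ (n - i)) = ((-1) ^ i * f $ i) * ((-1) ^ (n - i) * g $ (n - i))"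
    if "i \<in> {0..n}" for i :: nat
    using that power_add[of "-1::real" i "n - i"] by simp
  show "twist (f * g) $ n = (twist f * twist g) $ n"
    unfolding twist_def fps_mult_nth fps_nth_Abs_fps sum_distrib_left
    by (rule sum.cong[OF refl]) (rule eq)
qed

lemma sinh_fps_nth: "sinh_fps $ n = (if odd n then 1 / fact n else 0)"
  by (auto simp: sinh_fps_def)

lemma cosh_fps_nth: "cosh_fps $ n = (if even n then 1 / fact n else 0)"
  by (auto simp: cosh_fps_def)

text \<open>The expansion of \<open>y coth y\<close> in powers of \<open>y^2\<close>.\<close>

definition coth_fps :: "real fps" where
  "coth_fps = twist cot_fps"

lemma sinh_times_coth_fps: "sinh_fps * even_lift coth_fps = fps_X * cosh_fps"
proof -
  define s where "s = Abs_fps (\<lambda>N. (-1) ^ N / fact (2 * N + 1) :: real)"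
  define c where "c = Abs_fps (\<lambda>N. (-1) ^ N / fact (2 * N) :: real)"
  have sin: "fps_sin 1 = fps_X * even_lift s"
    by (rule fps_ext, subst odd_lift_nth) (auto simp: fps_sin_def s_def elim!: oddE)
  have cos: "fps_cos 1 = even_lift c"
    by (rule fps_ext) (auto simp: fps_cos_def c_def even_lift_nth elim!: evenE)
  have sinh: "sinh_fps = fps_X * even_lift (twist s)"
    by (rule fps_ext, subst odd_lift_nth)
       (auto simp: sinh_fps_nth s_def twist_def simp flip: power_add mult_2 elim!: oddE)
  have cosh: "cosh_fps = even_lift (twist c)"
    by (rule fps_ext)
       (auto simp: cosh_fps_nth c_def twist_def even_lift_nth simp flip: power_add mult_2 elim!: evenE)
  have "even_lift (s * cot_fps) = even_lift c"
    using sin_times_cot_fps unfolding sin cos mult.assoc even_lift_mult by simp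
  hence "twist s * coth_fps = twist c"
    unfolding coth_fps_def twist_mult[symmetric] by (metis even_lift_inject)
  thus ?thesis
    unfolding sinh cosh by (simp only: mult.assoc flip: even_lift_mult)
qed

text \<open>The expansion of \<open>y tanh y = 2y coth (2y) - y coth y\<close> in powers of \<open>y^2\<close>.\<close>

definition tanh_fps :: "real fps" where
  "tanh_fps = Abs_fps (\<lambda>m. (4 ^ m - 1) * coth_fps $ m)"

lemma sinh_fps_neq_0: "sinh_fps \<noteq> 0"
  using sinh_fps_nth[of 1] by force

text \<open>With \<open>D\<close> the substitution \<open>y \<mapsto> 2y\<close>, the doubling formulas give
  \<open>sinh (2y) \<sdot> y tanh y = 2y sinh^2 y\<close> for the series defined through \<open>coth\<close>; the factor
  \<open>2 sinh y\<close> can be cancelled because formal power series form an integral domain.\<close>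

lemma cosh_times_tanh_fps: "cosh_fps * even_lift tanh_fps = fps_X * sinh_fps"
proof -
  define D where "D = (\<lambda>f::real fps. f oo (fps_const 2 * fps_X))"
  have D_nth: "D f $ n = 2 ^ n * f $ n" for f n by (simp add: D_def)
  have D_mult: "D (f * g) = D f * D g" for f g
    unfolding D_def by (rule fps_compose_mult_distrib) simp
  have exp2: "fps_exp 2 = fps_exp 1 * (fps_exp 1 :: real fps)"
      "fps_exp (-2) = fps_exp (-1) * (fps_exp (-1) :: real fps)"
    using fps_exp_add_mult[of "1::real" 1] fps_exp_add_mult[of "-1::real" "-1"] by simp_all
  define h :: "real fps" where "h = fps_const (1/2)"
  have "h + h = 1" by (simp add: h_def)
  hence h: "h = 2 * (h * h)" by (metis distrib_right mult_1 mult_2)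
  have Ds: "D sinh_fps = 2 * sinh_fps * cosh_fps"
  proof -
    have "D sinh_fps = fps_const (1/2) * (fps_exp 2 - fps_exp (-2))"
      by (rule fps_ext) (simp add: D_nth sinh_fps_def power_minus[of "2::real"] right_diff_distrib)
    also have "\<dots> = 2 * (h * h) * (fps_exp 1 * fps_exp 1 - fps_exp (-1) * fps_exp (-1))"
      unfolding exp2 h_def[symmetric] h[symmetric] ..
    also have "\<dots> = 2 * sinh_fps * cosh_fps"
      unfolding sinh_fps_def cosh_fps_def h_def[symmetric] by (simp add: algebra_simps)
    finally show ?thesis .
  qed
  have Dc: "D cosh_fps = cosh_fps * cosh_fps + sinh_fps * sinh_fps"
  proof -
    have "D cosh_fps = h * (fps_exp 2 + fps_exp (-2))"
      unfolding h_def by (rule fps_ext) (simp add: D_nth cosh_fps_def power_minus[of "2::real"] distrib_left)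
    also have "\<dots> = 2 * (h * h) * (fps_exp 1 * fps_exp 1 + fps_exp (-1) * fps_exp (-1))"
      unfolding exp2 h[symmetric] ..
    also have "\<dots> = cosh_fps * cosh_fps + sinh_fps * sinh_fps"
      unfolding sinh_fps_def cosh_fps_def h_def[symmetric] by (simp add: algebra_simps)
    finally show ?thesis .
  qed
  have T_eq: "even_lift tanh_fps = D (even_lift coth_fps) - even_lift coth_fps"
  proof (rule fps_ext)
    fix n show "even_lift tanh_fps $ n = (D (even_lift coth_fps) - even_lift coth_fps) $ n"
      by (cases "even n") (auto simp: even_lift_nth tanh_fps_def D_nth left_diff_distrib power_mult elim!: evenE)
  qed
  have "D sinh_fps * even_lift tanh_fps
      = D (sinh_fps * even_lift coth_fps) - 2 * cosh_fps * (sinh_fps * even_lift coth_fps)"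
    unfolding T_eq D_mult Ds by (simp only: right_diff_distrib mult_ac)
  also have "\<dots> = 2 * fps_X * D cosh_fps - 2 * cosh_fps * (fps_X * cosh_fps)"
  proof -
    have "D fps_X = 2 * fps_X"
      unfolding numeral_fps_const by (rule fps_ext) (auto simp: D_nth le_Suc_eq)
    thus ?thesis unfolding sinh_times_coth_fps D_mult by simp
  qed
  also have "\<dots> = 2 * sinh_fps * (fps_X * sinh_fps)"
    unfolding Dc by (simp add: algebra_simps)
  finally have "2 * sinh_fps * (cosh_fps * even_lift tanh_fps) = 2 * sinh_fps * (fps_X * sinh_fps)"
    unfolding Ds by (simp add: mult.assoc)
  thus ?thesis using sinh_fps_neq_0 by (simp add: mult.assoc)
qed

section \<open>A binomial identity\<close>

lemma one_minus_2X_power_nth: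
  "((1 - 2 * fps_X) ^ n :: real fps) $ i = real (n choose i) * (-2) ^ i"
proof (induction n arbitrary: i)
  case 0
  show ?case by (cases i) auto
next
  case (Suc n)
  define q :: "real fps" where "q = (1 - 2 * fps_X) ^ n"
  have step: "((1 - 2 * fps_X) ^ Suc n :: real fps) = q - 2 * (fps_X * q)"
    by (simp add: q_def left_diff_distrib mult.assoc)
  have "q $ i = real (n choose i) * (-2) ^ i" for i
    unfolding q_def by (rule Suc.IH)
  thus ?case unfolding step
    by (cases i) (simp_all add: ring_distribs)
qed

text \<open>The expansion of \<open>(1 - z)^(-(d+1))\<close>.\<close>

definition binomial_column_fps :: "nat \<Rightarrow> real fps" where
  "binomial_column_fps d = Abs_fps (\<lambda>m. real ((d + m) choose d))"

lemma binomial_column_fps_Suc: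
  "(1 - fps_X) * binomial_column_fps (Suc d) = binomial_column_fps d"
proof (rule fps_ext)
  fix n show "((1 - fps_X) * binomial_column_fps (Suc d)) $ n = binomial_column_fps d $ n"
    by (cases n) (simp_all add: binomial_column_fps_def left_diff_distrib)
qed

text \<open>As a residue, the left-hand side is that of \<open>(1-2z)^(2N+1) / (z(1-z))^(d+1)\<close>, which the
  substitution \<open>w = z(1-z)\<close> turns into that of \<open>(1-4w)^N / w^(d+1)\<close>. Formally, the relation
  \<open>(1-2z)^2 = 1 - 4z(1-z)\<close> yields Pascal's rule in \<open>N\<close>.\<close>

lemma bessel_binomial_fps:
  "((1 - 2 * fps_X) ^ (2 * N + 1) * binomial_column_fps d) $ d = (-4) ^ d * real (N choose d)"
proof (induction N arbitrary: d)
  case 0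
  show ?case
  proof (cases d)
    case (Suc e)
    have "(2 * Suc e choose Suc e) = 2 * (Suc (2 * e) choose Suc e)"
      using binomial_symmetric[of e "Suc (2 * e)"] by simp
    thus ?thesis using Suc
      by (simp add: left_diff_distrib binomial_column_fps_def mult.assoc add_ac flip: mult_2)
  qed (simp add: left_diff_distrib binomial_column_fps_def mult.assoc)
next
  case (Suc N)
  let ?q = "1 - 2 * fps_X :: real fps"
  have split: "?q ^ (2 * Suc N + 1) = ?q ^ (2 * N + 1) - 4 * (fps_X * ((1 - fps_X) * ?q ^ (2 * N + 1)))"
  proof -
    have "?q ^ (2 * Suc N + 1) = ?q ^ (2 * N + 1) * (?q * ?q)" by simp
    also have "?q * ?q = 1 - 4 * (fps_X * (1 - fps_X))" by (simp add: algebra_simps)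
    finally show ?thesis by (simp add: algebra_simps)
  qed
  show ?case
  proof (cases d)
    case 0
    thus ?thesis by (simp add: binomial_column_fps_def fps_mult_nth one_minus_2X_power_nth)
  next
    case d: (Suc e)
    have "?q ^ (2 * Suc N + 1) * binomial_column_fps d = ?q ^ (2 * N + 1) * binomial_column_fps d
       - 4 * (fps_X * (?q ^ (2 * N + 1) * ((1 - fps_X) * binomial_column_fps d)))"
      unfolding split by (simp add: algebra_simps)
    also have "(1 - fps_X) * binomial_column_fps d = binomial_column_fps e"
      unfolding d by (rule binomial_column_fps_Suc)
    finally have "(?q ^ (2 * Suc N + 1) * binomial_column_fps d) $ d
        = (?q ^ (2 * N + 1) * binomial_column_fps d) $ d
          - 4 * (?q ^ (2 * N + 1) * binomial_column_fps e) $ e"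
      by (simp add: d del: power_Suc)
    thus ?thesis by (simp only: Suc.IH) (simp add: d algebra_simps)
  qed
qed

lemma bessel_binomial_identity:
  "(-4) ^ d * real (N choose d)
     = (\<Sum>i=0..d. (-2) ^ i * real ((2 * d - i) choose d) * real ((2 * N + 1) choose i))"
  unfolding bessel_binomial_fps[symmetric] fps_mult_nth one_minus_2X_power_nth
    binomial_column_fps_def fps_nth_Abs_fps
proof (rule sum.cong[OF refl])
  fix i assume "i \<in> {0..d}"
  hence "d + (d - i) = 2 * d - i" by auto
  thus "real ((2 * N + 1) choose i) * (-2) ^ i * real ((d + (d - i)) choose d)
      = (-2) ^ i * real ((2 * d - i) choose d) * real ((2 * N + 1) choose i)"
    by (simp only: mult_ac)
qed

section \<open>Derivatives of sine times hyperbolic cosine\<close>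

lemma fps_deriv_funpow_nth:
  "(fps_deriv ^^ i) f $ n = fact i * real ((n + i) choose i) * f $ (n + i)"
proof (induction i arbitrary: n)
  case (Suc i)
  have "real (Suc i) * real ((n + Suc i) choose Suc i) = real (Suc n) * real ((n + Suc i) choose i)"
    using arg_cong[OF Suc_times_binomial_add[of i n], of real]
    by (simp only: of_nat_mult add_Suc_right add.commute[of n i])
  moreover have "(fps_deriv ^^ Suc i) f $ n
      = fact i * (real (Suc n) * real ((n + Suc i) choose i)) * f $ (n + Suc i)"
    by (simp add: Suc mult_ac)
  ultimately have "(fps_deriv ^^ Suc i) f $ n
      = fact i * (real (Suc i) * real ((n + Suc i) choose Suc i)) * f $ (n + Suc i)"
    by (simp only:)
  thus ?case by (simp add: mult_ac)
qed simp

lemma X_power_fps_deriv_funpow_nth: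
  "(fps_X ^ i * (fps_deriv ^^ i) f) $ k = fact i * real (k choose i) * f $ k" for f :: "real fps"
  by (simp add: fps_X_power_mult_nth fps_deriv_funpow_nth)

lemma fps_deriv_sinh_fps: "fps_deriv sinh_fps = cosh_fps"
  by (simp add: sinh_fps_def cosh_fps_def flip: fps_const_neg)

lemma fps_deriv_cosh_fps: "fps_deriv cosh_fps = sinh_fps"
  by (simp add: sinh_fps_def cosh_fps_def flip: fps_const_neg)

lemma sin_cosh_derivs:
  "fps_deriv sin_cosh_fps = fps_cos 1 * cosh_fps + fps_sin 1 * sinh_fps"
  "(fps_deriv ^^ 2) sin_cosh_fps = 2 * (fps_cos 1 * sinh_fps)"
  "(fps_deriv ^^ 3) sin_cosh_fps = 2 * (fps_cos 1 * cosh_fps - fps_sin 1 * sinh_fps)"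
  "(fps_deriv ^^ 4) sin_cosh_fps = fps_const (-4) * sin_cosh_fps"
proof -
  have neg: "fps_deriv (fps_cos 1) = - (fps_sin 1 :: real fps)"
    by (simp add: fps_cos_deriv flip: fps_const_neg)
  have sin: "fps_deriv (fps_sin 1) = (fps_cos 1 :: real fps)" by (simp add: fps_sin_deriv)
  note rules = neg sin fps_deriv_sinh_fps fps_deriv_cosh_fps
  show 1: "fps_deriv sin_cosh_fps = fps_cos 1 * cosh_fps + fps_sin 1 * sinh_fps"
    by (simp add: rules)
  show 2: "(fps_deriv ^^ 2) sin_cosh_fps = 2 * (fps_cos 1 * sinh_fps)"
    unfolding numeral_2_eq_2 funpow.simps o_apply id_apply 1 by (simp add: rules algebra_simps)
  have d2: "fps_deriv (2 * f) = 2 * fps_deriv f" for f :: "real fps" by simp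
  have "(fps_deriv ^^ 3) sin_cosh_fps = fps_deriv ((fps_deriv ^^ 2) sin_cosh_fps)"
    by (simp add: eval_nat_numeral)
  thus 3: "(fps_deriv ^^ 3) sin_cosh_fps = 2 * (fps_cos 1 * cosh_fps - fps_sin 1 * sinh_fps)"
    unfolding 2 d2 by (simp add: rules algebra_simps)
  have "(fps_deriv ^^ 4) sin_cosh_fps = fps_deriv ((fps_deriv ^^ 3) sin_cosh_fps)"
    by (simp add: eval_nat_numeral)
  also have "\<dots> = - (4 * sin_cosh_fps)"
    unfolding 3 d2 by (simp add: rules algebra_simps)
  finally show "(fps_deriv ^^ 4) sin_cosh_fps = fps_const (-4) * sin_cosh_fps"
    by (simp add: numeral_fps_const flip: fps_const_neg)
qed

lemma fps_deriv_funpow_cmult: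
  "(fps_deriv ^^ k) (fps_const c * f) = fps_const c * (fps_deriv ^^ k) f" for f :: "real fps"
  by (induction k) simp_all

lemma sin_cosh_deriv_periodic:
  "(fps_deriv ^^ (4 * j + r)) sin_cosh_fps = fps_const ((-4) ^ j) * (fps_deriv ^^ r) sin_cosh_fps"
proof (induction j)
  case (Suc j)
  have "(fps_deriv ^^ (4 * Suc j + r)) sin_cosh_fps
      = (fps_deriv ^^ (4 * j + r)) ((fps_deriv ^^ 4) sin_cosh_fps)"
  proof -
    have "4 * Suc j + r = (4 * j + r) + 4" by simp
    thus ?thesis by (simp only: funpow_add o_apply)
  qed
  also have "\<dots> = fps_const (-4) * (fps_const ((-4) ^ j) * (fps_deriv ^^ r) sin_cosh_fps)"
    unfolding sin_cosh_derivs(4) fps_deriv_funpow_cmult Suc.IH ..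
  finally show ?case by (simp flip: mult.assoc)
qed simp

text \<open>\<open>S'/S = cot y + tanh y\<close> and \<open>S'''/S = 2 (cot y - tanh y)\<close>, written for both residues of the
  order modulo 4 at once; the factor \<open>(-4)^l\<close> from the periodicity and the 2 of the third
  derivative combine to \<open>(-1)^(j div 2) 2^j\<close>.\<close>

lemma odd_order_deriv:
  "fps_X ^ (2 * j + 1) * (fps_deriv ^^ (2 * j + 1)) sin_cosh_fps
    = sin_cosh_fps * (fps_const ((-1) ^ (j div 2) * 2 ^ j)
        * (fps_X ^ (2 * j) * even_lift (cot_fps + fps_const ((-1) ^ j) * tanh_fps)))"
proof -
  have lift: "even_lift (cot_fps + fps_const c * tanh_fps) = even_lift cot_fps + fps_const c * even_lift tanh_fps" for c
    by (rule fps_ext) (simp add: even_lift_nth)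
  have cc: "fps_X * (fps_cos 1 * cosh_fps) = sin_cosh_fps * even_lift cot_fps"
    unfolding mult.assoc[symmetric] sin_times_cot_fps[symmetric] by (simp only: mult_ac)
  have ss: "fps_X * (fps_sin 1 * sinh_fps) = sin_cosh_fps * even_lift tanh_fps"
    unfolding mult.left_commute[of fps_X] cosh_times_tanh_fps[symmetric] by (simp only: mult_ac)
  show ?thesis
  proof (cases "even j")
    case True
    then obtain l where l: "j = 2 * l" by blast
    have "(fps_deriv ^^ (2 * j + 1)) sin_cosh_fps
        = fps_const ((-4) ^ l) * (fps_cos 1 * cosh_fps + fps_sin 1 * sinh_fps)"
      using sin_cosh_deriv_periodic[of l 1] sin_cosh_derivs(1) by (simp add: l)
    hence deriv: "fps_X ^ (2 * j + 1) * (fps_deriv ^^ (2 * j + 1)) sin_cosh_fps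
        = fps_const ((-4) ^ l) * (fps_X ^ (2 * j) *
            (fps_X * (fps_cos 1 * cosh_fps) + fps_X * (fps_sin 1 * sinh_fps)))"
      by (simp only: power_add power_one_right distrib_left mult_ac)
    have coeff: "(-1) ^ (j div 2) * 2 ^ j = ((-4) ^ l :: real)"
      by (simp add: l power_mult flip: power_mult_distrib)
    have sign: "(-1) ^ j = (1 :: real)" using True by simp
    show ?thesis unfolding deriv cc ss lift unfolding coeff sign
      by (simp only: fps_const_1_eq_1 mult_1_left ring_distribs mult_ac)
  next
    case False
    then obtain l where l: "j = 2 * l + 1" by (elim oddE)
    have "(fps_deriv ^^ (2 * j + 1)) sin_cosh_fps
        = fps_const ((-4) ^ l) * (2 * (fps_cos 1 * cosh_fps - fps_sin 1 * sinh_fps))"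
    proof -
      have "2 * j + 1 = 4 * l + 3" by (simp add: l)
      thus ?thesis by (simp only: sin_cosh_deriv_periodic sin_cosh_derivs(3))
    qed
    hence deriv: "fps_X ^ (2 * j + 1) * (fps_deriv ^^ (2 * j + 1)) sin_cosh_fps
        = (fps_const ((-4) ^ l) * 2) * (fps_X ^ (2 * j) *
            (fps_X * (fps_cos 1 * cosh_fps) - fps_X * (fps_sin 1 * sinh_fps)))"
      by (simp only: power_add power_one_right right_diff_distrib mult_ac)
    have coeff: "fps_const ((-1) ^ (j div 2) * 2 ^ j) = fps_const ((-4) ^ l :: real) * 2"
      by (simp add: l power_mult numeral_fps_const flip: power_mult_distrib)
    have sign: "fps_const ((-1) ^ j) = (-1 :: real fps)"
      using False by (simp flip: fps_const_neg)
    show ?thesis unfolding deriv cc ss lift unfolding coeff sign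
      by (simp only: mult_minus_left mult_minus_right mult_1_left distrib_left distrib_right diff_conv_add_uminus mult_ac)
  qed
qed

text \<open>\<open>S''/S = 2 cot y tanh y\<close>.\<close>

lemma deriv_order_2_mod_4:
  "fps_X ^ (4 * j + 2) * (fps_deriv ^^ (4 * j + 2)) sin_cosh_fps
    = sin_cosh_fps * (fps_const ((-4) ^ j * 2) * (fps_X ^ (4 * j) * even_lift (tanh_fps * cot_fps)))"
proof -
  have "fps_X ^ (4 * j + 2) * (fps_deriv ^^ (4 * j + 2)) sin_cosh_fps
      = (fps_const ((-4) ^ j) * 2) * (fps_X ^ (4 * j) * ((fps_X * fps_cos 1) * (fps_X * sinh_fps)))"
    unfolding sin_cosh_deriv_periodic sin_cosh_derivs(2) power_add power2_eq_square
    by (simp only: mult_ac)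
  also have "fps_const ((-4) ^ j) * 2 = fps_const ((-4) ^ j * 2 :: real)"
    by (simp add: numeral_fps_const)
  finally show ?thesis
    unfolding sin_times_cot_fps[symmetric] cosh_times_tanh_fps[symmetric] even_lift_mult
    by (simp only: mult_ac)
qed

text \<open>Up to normalisation these are the coefficients of the Bessel polynomials: for \<open>w = y^2\<close> they
  express the \<open>d\<close>-th derivative with respect to \<open>w\<close> of \<open>S(y) / y\<close> through the derivatives of
  \<open>S\<close> with respect to \<open>y\<close>.\<close>

definition bessel_coeff :: "nat \<Rightarrow> nat \<Rightarrow> real" where
  "bessel_coeff d i = (-2) ^ i * real ((2 * d - i) choose d) / (4 ^ d * fact i)"

text \<open>The factor \<open>(2/\<pi>)^(2n)\<close> is the change of variable \<open>t = (2y/\<pi>)^2\<close>.\<close>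

abbreviation scaled_fps :: "nat \<Rightarrow> real fps" where
  "scaled_fps d \<equiv> Abs_fps (\<lambda>n. (2 / pi) ^ (2 * n) * nested_fps signed_inverse_square d $ n)"

lemma sin_cosh_nth_even: "even k \<Longrightarrow> sin_cosh_fps $ k = 0"
  unfolding fps_mult_nth by (rule sum.neutral) (auto simp: fps_sin_def cosh_fps_nth)

text \<open>On the coefficient of \<open>y^k\<close>, the operator \<open>y^i (d/dy)^i\<close> acts as multiplication by
  \<open>i! (k choose i)\<close>. Only odd \<open>k = 2N + 1\<close> matter, and for these the binomial identity says that
  the combination multiplies by \<open>(-1)^d (N choose d)\<close>.\<close>

lemma sin_cosh_times_scaled_fps:
  "sin_cosh_fps * even_lift (scaled_fps d)
     = (\<Sum>i=0..d. fps_const (bessel_coeff d i) * (fps_X ^ i * (fps_deriv ^^ i) sin_cosh_fps))"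
  unfolding sin_cosh_times_nested_fps
proof (rule fps_ext)
  fix k
  have rhs: "(\<Sum>i=0..d. fps_const (bessel_coeff d i) * (fps_X ^ i * (fps_deriv ^^ i) sin_cosh_fps)) $ k
     = (\<Sum>i=0..d. (-2) ^ i * real ((2 * d - i) choose d) * real (k choose i)) / 4 ^ d * sin_cosh_fps $ k"
    unfolding fps_sum_nth fps_mult_left_const_nth X_power_fps_deriv_funpow_nth sum_divide_distrib
      sum_distrib_right bessel_coeff_def
    by (rule sum.cong) auto
  show "Abs_fps (\<lambda>k. (-1) ^ d * real ((k div 2) choose d) * sin_cosh_fps $ k) $ k
     = (\<Sum>i=0..d. fps_const (bessel_coeff d i) * (fps_X ^ i * (fps_deriv ^^ i) sin_cosh_fps)) $ k"
  proof (cases "even k")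
    case True
    thus ?thesis unfolding rhs by (simp only: sin_cosh_nth_even fps_nth_Abs_fps mult_zero_right)
  next
    case False
    then obtain N where k: "k = 2 * N + 1" by (elim oddE)
    have "(-4) ^ d = (-1) ^ d * (4 ^ d :: real)" by (simp flip: power_mult_distrib)
    hence "(-1) ^ d * real (N choose d) = (-4) ^ d * real (N choose d) / 4 ^ d" by simp
    moreover have "(2 * N + 1) div 2 = N" by simp
    ultimately show ?thesis unfolding rhs unfolding k fps_nth_Abs_fps bessel_binomial_identity[symmetric]
      by (simp only:)
  qed
qed

lemma sum_split_mod_4:
  fixes f :: "nat \<Rightarrow> 'a :: comm_monoid_add"
  assumes "d \<ge> 1"
  shows "(\<Sum>i=0..d. f i) = (\<Sum>j=0..(d-1) div 2. f (2 * j + 1))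
     + ((\<Sum>j\<in>{j. 4 * j + 2 \<le> d}. f (4 * j + 2)) + (\<Sum>j\<in>{j. 4 * j \<le> d}. f (4 * j)))"
proof -
  have fin: "finite {j. 4 * j + 2 \<le> d}" "finite {j. 4 * j \<le> d}"
    by (rule finite_subset[of _ "{..d}"], auto)+
  have "{0..d} = (\<lambda>j. 2 * j + 1) ` {0..(d-1) div 2}
      \<union> ((\<lambda>j. 4 * j + 2) ` {j. 4 * j + 2 \<le> d} \<union> (\<lambda>j. 4 * j) ` {j. 4 * j \<le> d})" (is "_ = ?A \<union> (?B \<union> ?C)")
  proof (intro equalityI subsetI)
    fix i assume "i \<in> {0..d}"
    moreover have "i = 2 * (i div 2) + 1 \<or> i = 4 * (i div 4) + 2 \<or> i = 4 * (i div 4)" by presburger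
    moreover have "i = 2 * (i div 2) + 1 \<Longrightarrow> i \<le> d \<Longrightarrow> i div 2 \<le> (d - 1) div 2" by presburger
    ultimately show "i \<in> ?A \<union> (?B \<union> ?C)"
      by (smt (verit) UnI1 UnI2 atLeastAtMost_iff imageI le0 mem_Collect_eq)
  qed (use assms in auto)
  moreover have "?A \<inter> (?B \<union> ?C) = {}" by (auto; presburger)
  moreover have "?B \<inter> ?C = {}" by (auto; presburger)
  ultimately have "(\<Sum>i=0..d. f i) = sum f ?A + (sum f ?B + sum f ?C)"
    using fin by (simp add: sum.union_disjoint)
  thus ?thesis by (simp add: sum.reindex inj_on_def)
qed

lemma scaled_fps_closed_form:
  assumes "d \<ge> 1"
  shows "even_lift (scaled_fps d) =
    (\<Sum>j=0..(d-1) div 2. fps_const (bessel_coeff d (2 * j + 1) * ((-1) ^ (j div 2) * 2 ^ j))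
        * (fps_X ^ (2 * j) * even_lift (cot_fps + fps_const ((-1) ^ j) * tanh_fps)))
    + ((\<Sum>j\<in>{j. 4 * j + 2 \<le> d}. fps_const (bessel_coeff d (4 * j + 2) * ((-4) ^ j * 2))
        * (fps_X ^ (4 * j) * even_lift (tanh_fps * cot_fps)))
    + (\<Sum>j\<in>{j. 4 * j \<le> d}. fps_const (bessel_coeff d (4 * j) * (-4) ^ j) * fps_X ^ (4 * j)))"
    (is "_ = ?R")
proof -
  have zero: "fps_X ^ (4 * j) * (fps_deriv ^^ (4 * j)) sin_cosh_fps
      = sin_cosh_fps * (fps_const ((-4) ^ j) * fps_X ^ (4 * j))" for j
    using sin_cosh_deriv_periodic[of j 0] by (simp add: mult_ac)
  have pull: "fps_const b * (S * (fps_const c * Z)) = S * (fps_const (b * c) * Z)" for b c and S Z :: "real fps"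
    unfolding fps_const_mult[symmetric] by (simp only: mult_ac)
  have "sin_cosh_fps * even_lift (scaled_fps d) = sin_cosh_fps * ?R"
    unfolding sin_cosh_times_scaled_fps sum_split_mod_4[OF assms] odd_order_deriv deriv_order_2_mod_4 zero pull
    by (simp only: distrib_left sum_distrib_left)
  moreover have "fps_sin 1 $ 1 = (1 :: real)" "cosh_fps $ 0 = 1"
    by (simp_all add: fps_sin_def cosh_fps_nth)
  hence "fps_sin 1 \<noteq> (0 :: real fps)" "cosh_fps \<noteq> 0"
    by (metis fps_zero_nth zero_neq_one)+
  ultimately show ?thesis by simp
qed

section \<open>Reading off the coefficients\<close>

text \<open>Adding \<open>\<zeta>(m)\<close> to the alternating series cancels the odd terms and doubles the even ones.\<close>

lemma zeta_bar_eq_zeta: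
  assumes "m \<ge> 2"
  shows "zeta_bar m = (2 powi (1 - int m) - 1) * zeta m"
proof -
  have "summable (\<lambda>k. 1 / real (Suc k) ^ m)"
    using inverse_power_summable[of m, where ?'a = real] assms
    by (subst summable_Suc_iff) (simp add: field_simps)
  hence z: "(\<lambda>k. 1 / real (Suc k) ^ m) sums zeta m"
    using assms unfolding zeta_def by (simp add: summable_sums)
  have pow: "2 powi (1 - int m) = 2 / (2 ^ m :: real)"
    by (simp add: power_int_diff)
  have "(\<lambda>l. 2 / 2 ^ m * (1 / real (Suc l) ^ m)) sums (2 / 2 ^ m * zeta m)"
    by (rule sums_mult[OF z])
  moreover have "2 / 2 ^ m * (1 / real (Suc l) ^ m)
      = (1 + (-1) ^ Suc (2 * l + 1)) / real (Suc (2 * l + 1)) ^ m" for l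
  proof -
    have "real (Suc (2 * l + 1)) = 2 * real (Suc l)" by simp
    thus ?thesis by (simp only: power_mult_distrib) simp
  qed
  ultimately have "(\<lambda>l. (1 + (-1) ^ Suc (2 * l + 1)) / real (Suc (2 * l + 1)) ^ m) sums (2 / 2 ^ m * zeta m)"
    by simp
  moreover have "even k" if "k \<notin> range (\<lambda>l. 2 * l + 1)" for k :: nat
    using that by (metis oddE rangeI)
  ultimately have "(\<lambda>k. (1 + (-1) ^ Suc k) / real (Suc k) ^ m) sums (2 / 2 ^ m * zeta m)"
    by (subst (asm) sums_mono_reindex[of "\<lambda>l. 2 * l + 1" "\<lambda>k. (1 + (-1) ^ Suc k) / real (Suc k) ^ m"])
       (auto simp: strict_mono_def)
  from sums_diff[OF this z] have "(\<lambda>k. (-1) ^ Suc k / real (Suc k) ^ m) sums (2 / 2 ^ m * zeta m - zeta m)"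
    by (simp only: diff_divide_distrib[symmetric] add_diff_cancel_left')
  hence "zeta_bar m = 2 / 2 ^ m * zeta m - zeta m"
    unfolding zeta_bar_def by (rule sums_unique[symmetric])
  thus ?thesis unfolding pow by (simp add: algebra_simps)
qed

lemma Xi_eq_nested_fps: "nested_fps signed_inverse_square d $ n = Xi n d"
proof -
  have "nested_sum signed_inverse_square js = xi js" for js
  proof -
    have "(\<Union>K. decreasing_lists (length js) K)
        = {ns. length ns = length js \<and> sorted_wrt (>) ns \<and> (\<forall>k\<in>set ns. k \<ge> 1)}"
    proof (intro equalityI subsetI)
      fix ns :: "nat list" assume "ns \<in> {ns. length ns = length js \<and> sorted_wrt (>) ns \<and> (\<forall>k\<in>set ns. k \<ge> 1)}"
      hence "ns \<in> decreasing_lists (length js) (sum_list ns)"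
        by (auto simp: decreasing_lists_def member_le_sum_list)
      thus "ns \<in> (\<Union>K. decreasing_lists (length js) K)" by blast
    qed (auto simp: decreasing_lists_def)
    moreover have "monomial signed_inverse_square js ns
        = (\<Prod>i<length js. (-1) ^ (js ! i * ns ! i) / real (ns ! i) ^ (2 * (js ! i)))" for ns
      unfolding monomial_def signed_inverse_square_def
      by (simp add: power_divide mult.commute[of "js ! _"] flip: power_mult)
    ultimately show ?thesis by (simp add: nested_sum_def xi_def)
  qed
  thus ?thesis by (simp add: nested_fps_def Xi_def compositions_def)
qed

lemma tanh_fps_nth: "tanh_fps $ m = - 2 * (-1) ^ m * (4 ^ m - 1) * zeta (2 * m) / pi ^ (2 * m)"
  by (simp add: tanh_fps_def coth_fps_def twist_def cot_fps_def)

text \<open>Write \<open>m = n - j\<close>. The sign \<open>(-1)^j\<close> in front of \<open>tanh\<close> and the sign \<open>(-1)^m\<close> of its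
  coefficient multiply to \<open>(-1)^n\<close>. Hence the factor is \<open>1 + (4^m - 1) = 4^m\<close> for even \<open>n\<close> and \<open>2 - 4^m\<close> for odd \<open>n\<close>, where
  \<open>(2 - 4^m) \<zeta>(2m)\<close> is \<open>4^m\<close> times the alternating zeta value; this is why the parity of \<open>n\<close>
  alone selects the zeta function, independently of \<open>j\<close>.\<close>

lemma cot_tanh_nth:
  assumes "j < n"
  shows "(cot_fps + fps_const ((-1) ^ j) * tanh_fps) $ (n - j)
     = - 2 * 4 ^ (n - j) * zeta_tilde n (2 * n - 2 * j) / pi ^ (2 * n - 2 * j)"
proof -
  define m where "m = n - j"
  have m: "m \<ge> 1" "2 * n - 2 * j = 2 * m" "n = m + j" using assms by (auto simp: m_def)
  have sign: "(-1) ^ n = (-1) ^ j * ((-1) ^ m :: real)" by (simp add: m(3) power_add)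
  have 1: "(cot_fps + fps_const ((-1) ^ j) * tanh_fps) $ m
      = - 2 * ((1 + (-1) ^ n * (4 ^ m - 1)) * zeta (2 * m)) / pi ^ (2 * m)"
    unfolding sign by (simp add: cot_fps_def tanh_fps_nth field_simps)
  have "2 powi (1 - int (2 * m)) = 2 / (4 ^ m :: real)"
    by (simp add: power_int_diff power_int_mult power_mult)
  hence "zeta_bar (2 * m) = (2 / 4 ^ m - 1) * zeta (2 * m)"
    using zeta_bar_eq_zeta[of "2 * m"] m(1) by simp
  hence "(1 + (-1) ^ n * (4 ^ m - 1)) * zeta (2 * m) = 4 ^ m * zeta_tilde n (2 * m)"
    by (auto simp: zeta_tilde_def field_simps)
  thus ?thesis unfolding m(2) m_def[symmetric] 1 by simp
qed

lemma Xi_eq_scaled_nth: "Xi n d = (pi / 2) ^ (2 * n) * even_lift (scaled_fps d) $ (2 * n)"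
proof -
  have "(pi / 2) ^ (2 * n) * (2 / pi) ^ (2 * n) = (1 :: real)"
    by (simp flip: power_mult_distrib)
  thus ?thesis
    by (simp add: even_lift_nth Xi_eq_nested_fps flip: mult.assoc)
qed

lemma odd_term:
  assumes "1 \<le> d" "d \<le> n" "j \<le> (d - 1) div 2"
  shows "(pi / 2) ^ (2 * n) * (fps_const (bessel_coeff d (2 * j + 1) * ((-1) ^ (j div 2) * 2 ^ j))
      * (fps_X ^ (2 * j) * even_lift (cot_fps + fps_const ((-1) ^ j) * tanh_fps))) $ (2 * n)
    = (-1) ^ (j div 2) * pi ^ (2 * j) * zeta_tilde n (2 * n - 2 * j)
           / (2 ^ (2 * d - j - 2) * fact (2 * j + 1)) * real ((2 * d - 2 * j - 1) choose d)"
proof -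
  have j: "j < n" "j + 2 \<le> 2 * d" using assms by auto
  define m where "m = n - j"
  have n: "n = m + j" using j by (simp add: m_def)
  define Z where "Z = zeta_tilde n (2 * n - 2 * j)"
  define B where "B = real ((2 * d - 2 * j - 1) choose d)"
  define F :: real where "F = fact (2 * j + 1)"
  have F: "F > 0" by (simp add: F_def)
  have nth: "(fps_X ^ (2 * j) * even_lift (cot_fps + fps_const ((-1) ^ j) * tanh_fps)) $ (2 * n)
      = - 2 * 4 ^ m * Z / pi ^ (2 * m)"
  proof -
    have "2 * n - 2 * j = 2 * m" by (simp add: m_def)
    thus ?thesis using j(1) cot_tanh_nth[OF j(1)]
      unfolding fps_X_power_mult_nth even_lift_nth Z_def m_def by simp
  qed
  have bc: "bessel_coeff d (2 * j + 1) = - 2 * 4 ^ j * B / (4 ^ d * F)"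
    by (simp add: bessel_coeff_def B_def F_def power_mult)
  have "2 * d = 2 * d - j - 2 + j + 2" using j(2) by simp
  hence "(2::real) ^ (2 * d) = 2 ^ (2 * d - j - 2) * 2 ^ j * 2 ^ 2" by (metis power_add)
  hence 4: "(4::real) ^ d = 2 ^ (2 * d - j - 2) * 2 ^ j * 4" by (simp add: power_mult)
  have pi: "(pi / 2) ^ (2 * n) = pi ^ (2 * j) * pi ^ (2 * m) / (4 ^ m * 4 ^ j)"
    by (simp add: n power_divide power_add power_mult)
  show ?thesis
    unfolding fps_mult_left_const_nth nth bc pi 4 Z_def[symmetric] B_def[symmetric] F_def[symmetric]
    using F by (simp add: field_simps)
qed

lemma even_term:
  assumes "4 * j + 2 \<le> d" "d \<le> n"
  shows "(pi / 2) ^ (2 * n) * (fps_const (bessel_coeff d (4 * j + 2) * ((-4) ^ j * 2))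
        * (fps_X ^ (4 * j) * even_lift (tanh_fps * cot_fps))) $ (2 * n)
    = (\<Sum>(r, s) \<in> {(r, s). r + s = n - 2 * j}.
            (-1) ^ r * (4 ^ r - 1) / 4 ^ (n - 2 * j) * zeta (2 * r) * zeta (2 * s))
         * ((-1) ^ j * pi ^ (4 * j)
             / (2 powi (2 * int d - 2 * int j - 5) * fact (4 * j + 2)))
         * real ((2 * d - 4 * j - 2) choose d)"
proof -
  define m where "m = n - 2 * j"
  have n: "n = m + 2 * j" using assms by (simp add: m_def)
  define B where "B = real ((2 * d - 4 * j - 2) choose d)"
  define F :: real where "F = fact (4 * j + 2)"
  have F: "F > 0" by (simp add: F_def)
  define S where "S = (\<Sum>(r, s) \<in> {(r, s). r + s = m}. (-1) ^ r * (4 ^ r - 1) / 4 ^ m * zeta (2 * r) * zeta (2 * s))"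
  have "S = (\<Sum>r=0..m. (-1) ^ r * (4 ^ r - 1) / 4 ^ m * zeta (2 * r) * zeta (2 * (m - r)))"
    unfolding S_def
    by (rule sum.reindex_bij_witness[of _ "\<lambda>r. (r, m - r)" fst]) auto
  also have "\<dots> = pi ^ (2 * m) / (4 * 4 ^ m) * (tanh_fps * cot_fps) $ m"
    unfolding fps_mult_nth sum_distrib_left
  proof (rule sum.cong[OF refl])
    fix r assume "r \<in> {0..m}"
    hence "2 * m = 2 * r + 2 * (m - r)" by simp
    hence "pi ^ (2 * m) = pi ^ (2 * r) * pi ^ (2 * (m - r))" by (simp only: power_add)
    thus "(-1) ^ r * (4 ^ r - 1) / 4 ^ m * zeta (2 * r) * zeta (2 * (m - r))
        = pi ^ (2 * m) / (4 * 4 ^ m) * (tanh_fps $ r * cot_fps $ (m - r))"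
      by (simp only: tanh_fps_nth cot_fps_def fps_nth_Abs_fps) (simp add: field_simps)
  qed
  finally have S: "(tanh_fps * cot_fps) $ m = 4 * 4 ^ m * S / pi ^ (2 * m)"
    by (simp add: field_simps)
  have nth: "(fps_X ^ (4 * j) * even_lift (tanh_fps * cot_fps)) $ (2 * n) = 4 * 4 ^ m * S / pi ^ (2 * m)"
  proof -
    have "2 * n - 4 * j = 2 * m" "4 * j \<le> 2 * n" by (auto simp: n)
    thus ?thesis unfolding fps_X_power_mult_nth even_lift_nth by (simp add: S)
  qed
  have "2 * d - (4 * j + 2) = 2 * d - 4 * j - 2" by simp
  hence bc: "bessel_coeff d (4 * j + 2) = 4 * 16 ^ j * B / (4 ^ d * F)"
    by (simp only: bessel_coeff_def B_def F_def) (simp add: power_add power_mult)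
  have 2: "(2::real) powi (2 * int d - 2 * int j - 5) = 4 ^ d / (4 ^ j * 32)"
    by (simp add: power_int_diff power_int_mult)
  have pi: "(pi / 2) ^ (2 * n) = pi ^ (4 * j) * pi ^ (2 * m) / (4 ^ m * 16 ^ j)"
    by (simp add: n power_divide power_add power_mult power_mult_distrib)
  have neg: "(-4) ^ j = (-1) ^ j * (4 ^ j :: real)" by (simp flip: power_mult_distrib)
  show ?thesis
    unfolding fps_mult_left_const_nth nth bc pi 2 neg m_def[symmetric] S_def[symmetric]
      B_def[symmetric] F_def[symmetric]
    using F by (simp add: field_simps)
qed

lemma Xi_closed_form:
  assumes "1 \<le> d" "d \<le> n"
  shows "Xi n d =
      (\<Sum>j = 0..(d - 1) div 2.
         (-1) ^ (j div 2) * pi ^ (2 * j) * zeta_tilde n (2 * n - 2 * j)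
           / (2 ^ (2 * d - j - 2) * fact (2 * j + 1))
         * real ((2 * d - 2 * j - 1) choose d))
    + (\<Sum>j \<in> {j::nat. int j \<le> (int d - 2) div 4}.
         (\<Sum>(r, s) \<in> {(r, s). r + s = n - 2 * j}.
            (-1) ^ r * (4 ^ r - 1) / 4 ^ (n - 2 * j) * zeta (2 * r) * zeta (2 * s))
         * ((-1) ^ j * pi ^ (4 * j)
             / (2 powi (2 * int d - 2 * int j - 5) * fact (4 * j + 2)))
         * real ((2 * d - 4 * j - 2) choose d))"
proof -
  have idx: "{j::nat. int j \<le> (int d - 2) div 4} = {j. 4 * j + 2 \<le> d}" by auto
  \<comment> \<open>these monomials have degree \<open>4 j \<le> d < 2 n\<close>\<close>
  have const: "(\<Sum>j\<in>{j. 4 * j \<le> d}. (fps_const (bessel_coeff d (4 * j) * (-4) ^ j) * fps_X ^ (4 * j)) $ (2 * n)) = (0::real)"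
    using assms by (intro sum.neutral) auto
  show ?thesis
    unfolding Xi_eq_scaled_nth scaled_fps_closed_form[OF assms(1)] fps_add_nth fps_sum_nth const
      add_0_right distrib_left sum_distrib_left idx
    using odd_term[OF assms] even_term[OF _ assms(2)]
    by (intro arg_cong2[of _ _ _ _ "(+)"] sum.cong refl) auto
qed

lemma sin_cosh_nth_rational: "sin_cosh_fps $ k \<in> \<rat>"
proof -
  have "fact i \<in> (\<rat> :: real set)" for i by (metis Rats_of_nat of_nat_fact)
  thus ?thesis
    unfolding fps_mult_nth
    by (intro Rats_sum Rats_mult) (auto simp: fps_sin_def cosh_fps_nth intro!: Rats_divide Rats_power)
qed

text \<open>The coefficients are determined recursively by those of \<open>S = y + \<dots>\<close> and of its product with
  the series, all of which are rational.\<close>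

lemma scaled_fps_rational: "scaled_fps d $ n \<in> \<rat>"
proof (induction n rule: less_induct)
  case (less n)
  define Y where "Y = even_lift (scaled_fps d)"
  have Y_rat: "Y $ i \<in> \<rat>" if "i < 2 * n" for i
    using that less.IH[of "i div 2"] unfolding Y_def even_lift_nth by auto
  have "(Y * sin_cosh_fps) $ (2 * n + 1)
      = (\<Sum>i=0..<2*n. Y $ i * sin_cosh_fps $ (2 * n + 1 - i)) + (Y $ (2 * n) * sin_cosh_fps $ 1 + Y $ (2 * n + 1) * sin_cosh_fps $ 0)"
    unfolding fps_mult_nth[of Y] by (simp add: atLeastLessThanSuc_atLeastAtMost[symmetric])
  also have "sin_cosh_fps $ 1 = 1" by (simp add: fps_mult_nth fps_sin_def cosh_fps_nth)
  also have "sin_cosh_fps $ 0 = 0" by (simp add: fps_sin_def)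
  finally have "Y $ (2 * n) = (Y * sin_cosh_fps) $ (2 * n + 1)
      - (\<Sum>i=0..<2*n. Y $ i * sin_cosh_fps $ (2 * n + 1 - i))" by simp
  also have "\<dots> \<in> \<rat>"
  proof (intro Rats_diff Rats_sum Rats_mult Y_rat sin_cosh_nth_rational)
    show "(Y * sin_cosh_fps) $ (2 * n + 1) \<in> \<rat>"
      unfolding Y_def mult.commute[of _ sin_cosh_fps] sin_cosh_times_nested_fps fps_nth_Abs_fps
      by (intro Rats_mult sin_cosh_nth_rational) auto
  qed auto
  finally show ?case by (simp add: Y_def even_lift_nth)
qed

theorem theorem1p1:
  fixes n d :: nat
  assumes "1 \<le> d" and "d \<le> n"
  shows "(Xi n d =
      (\<Sum>j = 0..(d - 1) div 2.
         (-1) ^ (j div 2) * pi ^ (2 * j) * zeta_tilde n (2 * n - 2 * j)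
           / (2 ^ (2 * d - j - 2) * fact (2 * j + 1))
         * real ((2 * d - 2 * j - 1) choose d))
    + (\<Sum>j \<in> {j::nat. int j \<le> (int d - 2) div 4}.
         (\<Sum>(r, s) \<in> {(r, s). r + s = n - 2 * j}.
            (-1) ^ r * (4 ^ r - 1) / 4 ^ (n - 2 * j) * zeta (2 * r) * zeta (2 * s))
         * ((-1) ^ j * pi ^ (4 * j)
             / (2 powi (2 * int d - 2 * int j - 5) * fact (4 * j + 2)))
         * real ((2 * d - 4 * j - 2) choose d)))
    \<and> (\<forall>m\<ge>2. zeta_bar m = (2 powi (1 - int m) - 1) * zeta m)
    \<and> (\<exists>q\<in>\<rat>. Xi n d = q * pi ^ (2 * n))"
proof (intro conjI allI impI)
  have "Xi n d = (scaled_fps d $ n / 2 ^ (2 * n)) * pi ^ (2 * n)"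
    unfolding Xi_eq_scaled_nth even_lift_nth by (simp add: power_divide)
  moreover have "scaled_fps d $ n / 2 ^ (2 * n) \<in> \<rat>"
    by (intro Rats_divide scaled_fps_rational Rats_power) auto
  ultimately show "\<exists>q\<in>\<rat>. Xi n d = q * pi ^ (2 * n)" by blast
qed (use Xi_closed_form[OF assms] zeta_bar_eq_zeta in auto)

end
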